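(* Let $\mu,\nu>0$ with $\mu+\nu=1$ (so that $\nu<1$). For each integer $N\ge1$ let $C_N=N$ and let $(X_N(t))_{t\ge0}$ be the Engset process with $N$ sources, capacity $C_N=N$ and parameters $\nu,\mu$ (that is, the Ehrenfest process with $N$ particles), started at $X_N(0)=0$. Let $T_{C_N}^{X_N}=\inf\{s\ge0:X_N(s)=C_N\}$. Then the sequence of random variables $\left(N\nu^N\,T_{C_N}^{X_N}\right)$ converges in distribution, as $N\to+\infty$, to an exponentially distributed random variable with parameter $1-\nu$.
   Context: The Engset process $(X_N(t))_{t\ge0}$ with $N$ sources, capacity $C_N$ ($1\le C_N\le N$) and parameters $\nu,\mu>0$ is the continuous-time (right-continuous) birth and death Markov process on $\{0,1,\ldots,C_N\}$ with transition rates $q(x,x-1)=\mu x$ for $0\le x\le C_N$ and $q(x,x+1)=\nu(N-x)$ for $0\le x<C_N$. For $C_N=N$ it is the Ehrenfest process. The time scale is normalized so that $\mu+\nu=1$. An exponential random variable with parameter $\lambda$ has mean $1/\lambda$. *)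

theory Defs
  imports "HOL-Probability.Probability"
begin

text \<open>
  A rate function gives the transition rates between distinct states; the diagonal of the
  generator matrix is determined by requiring the rows to sum to zero.
\<close>

definition generator :: "'s set \<Rightarrow> ('s \<Rightarrow> 's \<Rightarrow> real) \<Rightarrow> 's \<Rightarrow> 's \<Rightarrow> real" where
  "generator S q x y = (if x = y then - (\<Sum>z\<in>S - {x}. q x z) else q x y)"

definition transition_function ::
    "'s set \<Rightarrow> ('s \<Rightarrow> 's \<Rightarrow> real) \<Rightarrow> (real \<Rightarrow> 's \<Rightarrow> 's \<Rightarrow> real) \<Rightarrow> bool" where
  "transition_function S q p \<longleftrightarrow>
    (\<forall>t\<ge>0. \<forall>x\<in>S. \<forall>y\<in>S. 0 \<le> p t x y) \<and>
    (\<forall>t\<ge>0. \<forall>x\<in>S. (\<Sum>y\<in>S. p t x y) = 1) \<and>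
    (\<forall>x\<in>S. \<forall>y\<in>S. p 0 x y = (if x = y then 1 else 0)) \<and>
    (\<forall>s\<ge>0. \<forall>t\<ge>0. \<forall>x\<in>S. \<forall>y\<in>S. p (s + t) x y = (\<Sum>z\<in>S. p s x z * p t z y)) \<and>
    (\<forall>x\<in>S. \<forall>y\<in>S. ((\<lambda>t. p t x y) has_real_derivative generator S q x y) (at_right 0))"

text \<open>
  Time-homogeneous right-continuous Markov process with finite state space \<open>S\<close> and transition
  rates \<open>q\<close>. States carry the discrete topology, so right-continuity means that every path is
  constant on some interval to the right of each time point. Only times \<open>t \<ge> 0\<close> matter.
\<close>

definition markov_jump_process ::
    "'a measure \<Rightarrow> nat set \<Rightarrow> (nat \<Rightarrow> nat \<Rightarrow> real) \<Rightarrow> (real \<Rightarrow> 'a \<Rightarrow> nat) \<Rightarrow> bool" where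
  "markov_jump_process M S q X \<longleftrightarrow>
    prob_space M \<and> finite S \<and>
    (\<forall>t\<ge>0. X t \<in> measurable M (count_space S)) \<and>
    (\<forall>\<omega>\<in>space M. \<forall>t\<ge>0. continuous (at_right t) (\<lambda>s. X s \<omega>)) \<and>
    (\<exists>p. transition_function S q p \<and>
      (\<forall>n t x. \<forall>y\<in>S. 0 \<le> t 0 \<longrightarrow> (\<forall>i\<le>n. t i < t (Suc i)) \<longrightarrow>
        \<P>(\<omega> in M. \<forall>i\<le>n. X (t i) \<omega> = x i) \<noteq> 0 \<longrightarrow>
        \<P>(\<omega> in M. X (t (Suc n)) \<omega> = y \<bar> \<forall>i\<le>n. X (t i) \<omega> = x i)
          = p (t (Suc n) - t n) (x n) y))"

definition engset_rate :: "nat \<Rightarrow> nat \<Rightarrow> real \<Rightarrow> real \<Rightarrow> nat \<Rightarrow> nat \<Rightarrow> real" where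
  "engset_rate N C \<nu> \<mu> x y =
    (if x = y + 1 then \<mu> * real x
     else if y = x + 1 \<and> x < C then \<nu> * (real N - real x)
     else 0)"

definition engset_process ::
    "'a measure \<Rightarrow> nat \<Rightarrow> nat \<Rightarrow> real \<Rightarrow> real \<Rightarrow> (real \<Rightarrow> 'a \<Rightarrow> nat) \<Rightarrow> bool" where
  "engset_process M N C \<nu> \<mu> X \<longleftrightarrow>
    1 \<le> C \<and> C \<le> N \<and> 0 < \<nu> \<and> 0 < \<mu> \<and> markov_jump_process M {0..C} (engset_rate N C \<nu> \<mu>) X"

text \<open>Extended-real valued, so that it is \<open>\<infinity>\<close> on paths that never visit \<open>c\<close>.\<close>

definition hitting_time :: "(real \<Rightarrow> 'a \<Rightarrow> nat) \<Rightarrow> nat \<Rightarrow> 'a \<Rightarrow> ereal" where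
  "hitting_time X c \<omega> = (INF s\<in>{s. 0 \<le> s \<and> X s \<omega> = c}. ereal s)"

text \<open>
  Convergence in distribution of extended-real valued random variables \<open>Y n\<close> to a real limit law
  \<open>L\<close>: the distribution functions \<open>x \<mapsto> P (Y n \<le> x)\<close> converge at every continuity point of
  \<^term>\<open>cdf L\<close>. For real valued \<open>Y n\<close> this is \<^const>\<open>weak_conv_m\<close> of the laws.
\<close>

definition converges_in_distribution ::
    "(nat \<Rightarrow> 'a measure) \<Rightarrow> (nat \<Rightarrow> 'a \<Rightarrow> ereal) \<Rightarrow> real measure \<Rightarrow> bool" where
  "converges_in_distribution M Y L \<longleftrightarrow>
    weak_conv (\<lambda>n x. \<P>(\<omega> in M n. Y n \<omega> \<le> ereal x)) (cdf L)"

end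

theory Submission
  imports Defs
begin

text \<open>
  The Ehrenfest particles are independent, so the transition probabilities into the full state \<open>N\<close>
  are explicit: \<open>p t 0 N = (\<nu> * (1 - exp (- t))) ^ N\<close> and \<open>p t N N = (\<nu> + \<mu> * exp (- t)) ^ N\<close>. The
  hitting time \<open>H\<close> of \<open>N\<close> therefore solves the renewal equation \<open>p t 0 N = E (p (t - H) N N; H \<le> t)\<close>.
  Integrate it over \<open>[0, t]\<close> and put \<open>t = x / (N * \<nu> ^ N)\<close>. The left-hand side becomes \<open>x + o(1)\<close>
  after multiplication by \<open>N\<close>. The kernel \<open>p s N N\<close> is the stationary probability \<open>\<nu> ^ N\<close> plus an
  excess of total mass \<open>(1 + o(1)) / (N * \<mu>)\<close> concentrated near \<open>0\<close>. Hence the distribution function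
  \<open>\<phi>\<close> of \<open>N * \<nu> ^ N * H\<close> satisfies \<open>x = \<integral>\<^bsub>0\<^esub>\<^bsup>x\<^esup> \<phi> + \<phi> x / \<mu> + o(1)\<close>, whose solution without the error
  term is \<open>1 - exp (- \<mu> * x)\<close>.
\<close>

subsection \<open>Transition functions\<close>

text \<open>In the full state each of the N particles leaves at rate \<mu>, so a visit lasts about 1
  / (N * \<mu>): this is the excess mass. Divided by the stationary weight \<open>\<nu> ^ N\<close>
  it gives the mean hitting time, about 1 / (N * \<mu> * \<nu> ^ N), hence the parameter \<mu> = 1 -
  \<nu> on the chosen time scale. Two obstacles shape the argument. The Markov property is given at
  deterministic times only, whereas the renewal equation restarts the process at a random time;
  first visits on ever finer grids replace the strong Markov property. And \<phi> may have jumps, so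
  the limiting equation cannot simply be differentiated; it is exploited through one-sided
  inequalities for the increments of the integral of \<phi>. Integrating the renewal equation has
  the effect that only the total mass of the excess matters, not its shape near 0.\<close>

lemma transition_function_le_1:
  assumes "transition_function S q p" "finite S" "0 \<le> t" "x \<in> S" "y \<in> S"
  shows "p t x y \<le> 1"
proof -
  have "p t x y \<le> (\<Sum>y\<in>S. p t x y)"
    using assms by (intro member_le_sum) (auto simp: transition_function_def)
  also have "\<dots> = 1"
    using assms by (auto simp: transition_function_def)
  finally show ?thesis .
qed

lemma transition_function_quotient:
  assumes p: "transition_function S q p" and S: "x \<in> S" "y \<in> S"
  shows "((\<lambda>h. (p h x y - (if x = y then 1 else 0)) / h) \<longlongrightarrow> generator S q x y) (at_right 0)"
proof -
  have "((\<lambda>t. p t x y) has_real_derivative generator S q x y) (at_right 0)" "p 0 x y = (if x = y then 1 else 0)"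
    using p S by (auto simp: transition_function_def)
  then show ?thesis
    by (simp add: has_field_derivative_iff)
qed

lemma transition_function_continuous_0:
  assumes p: "transition_function S q p" and S: "x \<in> S" "y \<in> S"
  shows "((\<lambda>h. p h x y) \<longlongrightarrow> (if x = y then 1 else 0)) (at_right 0)"
proof -
  have d: "((\<lambda>t. p t x y) has_real_derivative generator S q x y) (at_right 0)" "p 0 x y = (if x = y then 1 else 0)"
    using p S by (auto simp: transition_function_def)
  have "continuous (at_right 0) (\<lambda>t. p t x y)"
    using d(1) by (rule DERIV_continuous)
  then show ?thesis
    using d(2) by (simp add: continuous_within)
qed

text \<open>Chapman-Kolmogorov with the identity matrix subtracted: every increment of
  \<open>p\<close> is expressed through increments from time 0, the only place where a derivative is
  given.\<close>

lemma transition_function_increment: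
  assumes p: "transition_function S q p" and fin: "finite S" and S: "x \<in> S" "y \<in> S"
    and "0 \<le> s" "0 \<le> h"
  shows "p (s + h) x y - p s x y = (\<Sum>z\<in>S. p s x z * (p h z y - (if z = y then 1 else 0)))"
proof -
  have "\<forall>s\<ge>0. \<forall>t\<ge>0. \<forall>x\<in>S. \<forall>y\<in>S. p (s + t) x y = (\<Sum>z\<in>S. p s x z * p t z y)"
    using p by (simp add: transition_function_def)
  then have "p (s + h) x y = (\<Sum>z\<in>S. p s x z * p h z y)"
    using assms by blast
  moreover have "p s x y = (\<Sum>z\<in>S. p s x z * (if z = y then 1 else 0))"
    using fin S by (simp add: if_distrib cong: if_cong)
  ultimately show ?thesis
    by (simp add: sum_subtractf right_diff_distrib)
qed

text \<open>The increment formula from t - h to t has factors \<open>p (t - h) x z\<close> in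
  [0, 1], so it is bounded by increments from time 0. The left difference quotient of the forward
  equation contains these factors and needs their limit.\<close>

lemma transition_function_left_continuous:
  assumes p: "transition_function S q p" and fin: "finite S" and t: "0 < t" and S: "x \<in> S" "y \<in> S"
  shows "((\<lambda>h. p (t - h) x y) \<longlongrightarrow> p t x y) (at_right 0)"
proof -
  let ?d = "\<lambda>z y. if z = y then 1 else 0 :: real"
  have ev: "eventually (\<lambda>h. 0 < h \<and> h < t) (at_right 0)"
    using eventually_at_right_real[OF t] by (rule eventually_mono) auto
  have "((\<lambda>h. p t x y - p (t - h) x y) \<longlongrightarrow> 0) (at_right 0)"
  proof (rule Lim_null_comparison)
    show "\<forall>\<^sub>F h in at_right 0. norm (p t x y - p (t - h) x y) \<le> (\<Sum>z\<in>S. \<bar>p h z y - ?d z y\<bar>)"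
      using ev
    proof eventually_elim
      case (elim h)
      have "p t x y - p (t - h) x y = (\<Sum>z\<in>S. p (t - h) x z * (p h z y - ?d z y))"
        using transition_function_increment[OF p fin S, of "t - h" h] elim by simp
      also have "\<bar>\<dots>\<bar> \<le> (\<Sum>z\<in>S. \<bar>p (t - h) x z * (p h z y - ?d z y)\<bar>)"
        by (rule sum_abs)
      also have "\<dots> \<le> (\<Sum>z\<in>S. \<bar>p h z y - ?d z y\<bar>)"
      proof (rule sum_mono)
        fix z assume "z \<in> S"
        then have "\<bar>p (t - h) x z\<bar> \<le> 1"
          using transition_function_le_1[OF p fin, of "t - h" x z] p S elim
          by (auto simp: transition_function_def)
        then show "\<bar>p (t - h) x z * (p h z y - ?d z y)\<bar> \<le> \<bar>p h z y - ?d z y\<bar>"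
          by (simp add: abs_mult mult_left_le_one_le)
      qed
      finally show ?case by simp
    qed
    have "((\<lambda>h. \<Sum>z\<in>S. \<bar>p h z y - ?d z y\<bar>) \<longlongrightarrow> (\<Sum>z\<in>S. \<bar>?d z y - ?d z y\<bar>)) (at_right 0)"
      using S by (intro tendsto_intros transition_function_continuous_0[OF p]) auto
    then show "((\<lambda>h. \<Sum>z\<in>S. \<bar>p h z y - ?d z y\<bar>) \<longlongrightarrow> 0) (at_right 0)"
      by simp
  qed
  from tendsto_diff[OF tendsto_const[of "p t x y"] this] show ?thesis by simp
qed

lemma transition_function_forward:
  assumes p: "transition_function S q p" and fin: "finite S" and t: "0 < t" and S: "x \<in> S" "y \<in> S"
  shows "((\<lambda>t. p t x y) has_real_derivative (\<Sum>z\<in>S. p t x z * generator S q z y)) (at t)"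
proof -
  let ?d = "\<lambda>z y. if z = y then 1 else 0 :: real"
  let ?D = "\<Sum>z\<in>S. p t x z * generator S q z y"
  note key = transition_function_increment[OF p fin S]
  have ev: "eventually (\<lambda>h. 0 < h \<and> h < t) (at_right 0)"
    using eventually_at_right_real[OF t] by (rule eventually_mono) auto
  have right: "((\<lambda>h. (p (t + h) x y - p t x y) / h) \<longlongrightarrow> ?D) (at_right 0)"
  proof (rule Lim_transform_eventually)
    show "((\<lambda>h. \<Sum>z\<in>S. p t x z * ((p h z y - ?d z y) / h)) \<longlongrightarrow> ?D) (at_right 0)"
      using S by (intro tendsto_intros transition_function_quotient[OF p]) auto
    show "\<forall>\<^sub>F h in at_right 0. (\<Sum>z\<in>S. p t x z * ((p h z y - ?d z y) / h)) = (p (t + h) x y - p t x y) / h"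
      using ev by eventually_elim (use t in \<open>simp add: key sum_divide_distrib\<close>)
  qed
  have left: "((\<lambda>h. (p (t + h) x y - p t x y) / h) \<longlongrightarrow> ?D) (at_left 0)"
  proof -
    have "((\<lambda>h. (p (t + - h) x y - p t x y) / - h) \<longlongrightarrow> ?D) (at_right 0)"
    proof (rule Lim_transform_eventually)
      show "((\<lambda>h. \<Sum>z\<in>S. p (t - h) x z * ((p h z y - ?d z y) / h)) \<longlongrightarrow> ?D) (at_right 0)"
        using S by (intro tendsto_intros transition_function_quotient[OF p]
            transition_function_left_continuous[OF p fin t]) auto
      show "\<forall>\<^sub>F h in at_right 0. (\<Sum>z\<in>S. p (t - h) x z * ((p h z y - ?d z y) / h)) = (p (t + - h) x y - p t x y) / - h"
        using ev
      proof eventually_elim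
        case (elim h)
        have "p t x y - p (t - h) x y = (\<Sum>z\<in>S. p (t - h) x z * (p h z y - ?d z y))"
          using key[of "t - h" h] elim by simp
        then have "(\<Sum>z\<in>S. p (t - h) x z * ((p h z y - ?d z y) / h)) = (p t x y - p (t - h) x y) / h"
          by (simp add: sum_divide_distrib)
        then show ?case by (simp add: minus_divide_left)
      qed
    qed
    then show ?thesis
      by (simp add: filterlim_at_left_to_right)
  qed
  show ?thesis
    unfolding DERIV_def using left right by (simp add: filterlim_split_at)
qed

lemma transition_function_continuous_on:
  assumes p: "transition_function S q p" and fin: "finite S" and S: "x \<in> S" "y \<in> S"
  shows "continuous_on {0..} (\<lambda>s. p s x y)"
  unfolding continuous_on_eq_continuous_within
proof
  fix s :: real assume s: "s \<in> {0..}"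
  show "continuous (at s within {0..}) (\<lambda>s. p s x y)"
  proof (cases "s = 0")
    case True
    have "((\<lambda>t. p t x y) has_real_derivative generator S q x y) (at_right 0)"
      using p S by (auto simp: transition_function_def)
    then have "continuous (at_right 0) (\<lambda>t. p t x y)"
      by (rule DERIV_continuous)
    moreover have "at (0::real) within {0..} = at_right 0"
    proof -
      have "{0..} - {0} = {0::real<..} - {0}" by auto
      then show ?thesis by (simp add: at_within_def)
    qed
    ultimately show ?thesis using True by simp
  next
    case False
    then show ?thesis
      using transition_function_forward[OF p fin _ S, of s] s DERIV_isCont continuous_at_imp_continuous_at_within
      by (metis atLeast_iff order_le_less)
  qed
qed

text \<open>Duality: \<open>s \<mapsto> \<Sum>y. p s x y * h (T - s) y\<close> is constant.\<close>

lemma transition_function_backward_solution: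
  assumes p: "transition_function S q p" and fin: "finite S" and T: "0 < T" and x: "x \<in> S"
    and h: "\<And>u y. y \<in> S \<Longrightarrow>
      ((\<lambda>u. h u y) has_real_derivative (\<Sum>z\<in>S. generator S q y z * h u z)) (at u)"
  shows "(\<Sum>y\<in>S. p T x y * h 0 y) = h T x"
proof -
  define m where "m s = (\<Sum>y\<in>S. p s x y * h (T - s) y)" for s
  have hc: "continuous_on A (\<lambda>s. h (T - s) y)" if "y \<in> S" for y A
  proof -
    have "continuous_on UNIV (\<lambda>u. h u y)"
      using h[OF that] DERIV_isCont by (auto simp: continuous_on_eq_continuous_at)
    then show ?thesis
      by (rule continuous_on_compose2) (auto intro!: continuous_intros)
  qed
  note pc = transition_function_continuous_on[OF p fin x]
  have "m T = m 0"
  proof (rule DERIV_isconst_end[OF T])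
    show "continuous_on {0..T} m"
      unfolding m_def by (intro continuous_intros continuous_on_subset[OF pc] hc) auto
    fix s assume s: "0 < s" "s < T"
    have "(m has_real_derivative (\<Sum>y\<in>S. (\<Sum>z\<in>S. p s x z * generator S q z y) * h (T - s) y
        + p s x y * - (\<Sum>z\<in>S. generator S q y z * h (T - s) z))) (at s)"
      unfolding m_def
    proof (rule DERIV_sum)
      fix y assume y: "y \<in> S"
      have "((\<lambda>s. h (T - s) y) has_real_derivative (\<Sum>z\<in>S. generator S q y z * h (T - s) z) * (-1)) (at s)"
        by (rule DERIV_chain2[OF h[OF y]]) (auto intro!: derivative_eq_intros)
      from DERIV_mult[OF transition_function_forward[OF p fin s(1) x y] this]
      show "((\<lambda>s. p s x y * h (T - s) y) has_real_derivative (\<Sum>z\<in>S. p s x z * generator S q z y) * h (T - s) y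
        + p s x y * - (\<Sum>z\<in>S. generator S q y z * h (T - s) z)) (at s)"
        by (simp add: algebra_simps)
    qed
    \<comment> \<open>Exchanging the sums moves the generator from \<open>p\<close> to
      \<open>h\<close>: the forward equation of one factor cancels the backward equation of the
      other.\<close>
    moreover have "(\<Sum>y\<in>S. (\<Sum>z\<in>S. p s x z * generator S q z y) * h (T - s) y) =
        (\<Sum>y\<in>S. p s x y * (\<Sum>z\<in>S. generator S q y z * h (T - s) z))"
      unfolding sum_distrib_left sum_distrib_right by (subst sum.swap) (simp add: mult.assoc)
    ultimately show "(m has_real_derivative 0) (at s)"
      by (simp add: sum_subtractf)
  qed
  moreover have "m 0 = h T x"
  proof -
    have "m 0 = (\<Sum>y\<in>S. if x = y then h T y else 0)"
      using p x unfolding m_def transition_function_def by (intro sum.cong) auto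
    also have "\<dots> = h T x" using fin x by simp
    finally show ?thesis .
  qed
  ultimately show ?thesis by (simp add: m_def)
qed

subsection \<open>Transition probabilities of the Ehrenfest process\<close>

lemma generator_sum:
  assumes "finite S" "x \<in> S"
  shows "(\<Sum>z\<in>S. generator S q x z * f z) = (\<Sum>z\<in>S - {x}. q x z * (f z - f x))"
proof -
  have "(\<Sum>z\<in>S. generator S q x z * f z) =
      generator S q x x * f x + (\<Sum>z\<in>S - {x}. generator S q x z * f z)"
    using assms by (rule sum.remove)
  also have "(\<Sum>z\<in>S - {x}. generator S q x z * f z) = (\<Sum>z\<in>S - {x}. q x z * f z)"
    by (intro sum.cong) (auto simp: generator_def)
  finally show ?thesis
    by (simp add: generator_def sum_subtractf algebra_simps sum_distrib_left)
qed

lemma ehrenfest_generator_sum: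
  assumes x: "x \<le> N"
  shows "(\<Sum>z\<in>{0..N}. generator {0..N} (engset_rate N N \<nu> \<mu>) x z * f z) =
    \<mu> * real x * (f (x - 1) - f x) + \<nu> * real (N - x) * (f (x + 1) - f x)"
proof -
  let ?q = "engset_rate N N \<nu> \<mu>" and ?g = "\<lambda>z. engset_rate N N \<nu> \<mu> x z * (f z - f x)"
  have "(\<Sum>z\<in>{0..N}. generator {0..N} ?q x z * f z) = (\<Sum>z\<in>{0..N} - {x}. ?g z)"
    using x by (intro generator_sum) auto
  also have "\<dots> = (\<Sum>z\<in>({0..N} - {x}) \<inter> {x - 1, x + 1}. ?g z)"
    by (intro sum.mono_neutral_right) (auto simp: engset_rate_def)
  also have "\<dots> = \<mu> * real x * (f (x - 1) - f x) + \<nu> * real (N - x) * (f (x + 1) - f x)"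
  proof -
    \<comment> \<open>The neighbours that leave the state space, below 0 and above N, carry the
      coefficient 0 in the claimed formula, so it needs no boundary cases.\<close>
    have "({0..N} - {x}) \<inter> {x - 1, x + 1} =
        (if x = 0 then {} else {x - 1}) \<union> (if x = N then {} else {x + 1})"
      using x by auto
    then show ?thesis
      using x by (auto simp: engset_rate_def of_nat_diff)
  qed
  finally show ?thesis .
qed

text \<open>
  Each of the \<open>N\<close> particles evolves independently, and \<open>\<nu> * (1 - exp (- t))\<close> and
  \<open>\<nu> + \<mu> * exp (- t)\<close> are the probabilities that a particle is up at time \<open>t\<close> when it starts
  down, respectively up.
\<close>

lemma ehrenfest_transition_to_top:
  assumes p: "transition_function {0..N} (engset_rate N N \<nu> \<mu>) p"
    and \<mu>\<nu>: "\<mu> + \<nu> = 1" and t: "0 \<le> t" and x: "x \<le> N"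
  shows "p t x N = (\<nu> * (1 - exp (- t))) ^ (N - x) * (\<nu> + \<mu> * exp (- t)) ^ x"
proof (cases "t = 0")
  case True
  have "p 0 x N = (if x = N then 1 else 0)"
    using p x unfolding transition_function_def by auto
  then show ?thesis using True \<mu>\<nu> x by (simp add: add.commute)
next
  case False
  define h where "h u y = (\<nu> * (1 - exp (- u))) ^ (N - y) * (\<nu> + \<mu> * exp (- u)) ^ y" for u :: real and y
  have "(\<Sum>y\<in>{0..N}. p t x y * h 0 y) = h t x"
  proof (rule transition_function_backward_solution[OF p])
    fix u :: real and y assume "y \<in> {0..N}"
    then have y: "y \<le> N" by simp
    let ?a = "\<nu> * (1 - exp (- u))" and ?b = "\<nu> + \<mu> * exp (- u)" and ?e = "exp (- u)"
    \<comment> \<open>A step in y exchanges one factor \<open>?a\<close> for \<open>?b\<close>, so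
      each increment in the generator contains \<open>?b - ?a\<close>, which is the exponential that
      differentiation in u produces.\<close>
    have "?b - ?a = (\<mu> + \<nu>) * ?e"
      by (simp add: algebra_simps)
    then have ba: "?b - ?a = ?e"
      using \<mu>\<nu> by simp
    have d: "((\<lambda>u. h u y) has_real_derivative
        real (N - y) * ?a ^ (N - y - 1) * (\<nu> * ?e) * ?b ^ y
        + - (?a ^ (N - y)) * (real y * ?b ^ (y - 1) * (\<mu> * ?e))) (at u)"
      unfolding h_def by (auto intro!: derivative_eq_intros simp: algebra_simps)
    have e1: "\<mu> * real y * (h u (y - 1) - h u y) = - (?a ^ (N - y)) * (real y * ?b ^ (y - 1) * (\<mu> * ?e))"
    proof (cases y)
      case (Suc k)
      then have "N - (y - 1) = Suc (N - y)" using y by simp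
      then have "h u (y - 1) - h u y = ?a ^ (N - y) * ?b ^ k * (?a - ?b)"
        using Suc by (simp add: h_def algebra_simps)
      also have "?a - ?b = - ?e" using ba by simp
      finally show ?thesis using Suc by simp
    qed simp
    have e2: "\<nu> * real (N - y) * (h u (y + 1) - h u y) = real (N - y) * ?a ^ (N - y - 1) * (\<nu> * ?e) * ?b ^ y"
    proof (cases "N - y")
      case (Suc k)
      then have "N - (y + 1) = k" by simp
      then have "h u (y + 1) - h u y = ?a ^ k * ?b ^ y * (?b - ?a)"
        using Suc by (simp add: h_def algebra_simps)
      also have "?b - ?a = ?e" by (rule ba)
      finally show ?thesis using Suc by simp
    qed simp
    show "((\<lambda>u. h u y) has_real_derivative
        (\<Sum>z\<in>{0..N}. generator {0..N} (engset_rate N N \<nu> \<mu>) y z * h u z)) (at u)"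
      using d unfolding ehrenfest_generator_sum[OF y] e1 e2 by (simp only: add.commute)
  qed (use t x False in auto)
  \<comment> \<open>At time 0 the two bases are 0 and 1, so \<open>h 0\<close> is the indicator of
    the full state (with 0 ^ 0 = 1) and the duality sum collapses to \<open>p t x N\<close>.\<close>
  moreover have "h 0 y = (if y = N then 1 else 0)" if "y \<le> N" for y
    using that \<mu>\<nu> by (auto simp: h_def add.commute)
  then have "(\<Sum>y\<in>{0..N}. p t x y * h 0 y) = (\<Sum>y\<in>{0..N}. if y = N then p t x y else 0)"
    by (intro sum.cong) auto
  ultimately show ?thesis
    by (simp add: h_def)
qed

subsection \<open>Hitting times of right-continuous paths\<close>

lemma right_continuous_discrete:
  fixes x :: "real \<Rightarrow> nat"
  assumes "continuous (at_right t) x"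
  shows "\<exists>\<eta>>0. \<forall>s. t \<le> s \<longrightarrow> s < t + \<eta> \<longrightarrow> x s = x t"
proof -
  have "(x \<longlongrightarrow> x t) (at_right t)"
    using assms by (simp only: continuous_within)
  then have "eventually (\<lambda>s. x s = x t) (at_right t)"
    by (simp only: tendsto_discrete)
  then obtain b where b: "b > t" "\<forall>s>t. s < b \<longrightarrow> x s = x t"
    unfolding eventually_at_right_field by blast
  have "x s = x t" if "t \<le> s" "s < t + (b - t)" for s
  proof (cases "s = t")
    case False
    then have "t < s" "s < b" using that by linarith+
    with b(2) show ?thesis by blast
  qed simp
  moreover have "0 < b - t" using b(1) by simp
  ultimately show ?thesis by blast
qed

lemma hitting_time_nonneg: "0 \<le> hitting_time X c \<omega>"
  unfolding hitting_time_def by (auto intro!: INF_greatest)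

text \<open>There are visits arbitrarily close above the infimum, and right continuity gives the
  path the same value at the infimum itself, which is therefore a minimum.\<close>

lemma hitting_time_attained:
  assumes rc: "\<And>t. 0 \<le> t \<Longrightarrow> continuous (at_right t) (\<lambda>s. X s \<omega>)"
    and fin: "hitting_time X c \<omega> \<noteq> \<infinity>"
  shows "\<exists>s\<ge>0. hitting_time X c \<omega> = ereal s \<and> X s \<omega> = c \<and> (\<forall>r. 0 \<le> r \<longrightarrow> r < s \<longrightarrow> X r \<omega> \<noteq> c)"
proof -
  let ?A = "{s. 0 \<le> s \<and> X s \<omega> = c}"
  have ne: "?A \<noteq> {}"
  proof
    assume "?A = {}"
    then have "hitting_time X c \<omega> = \<infinity>"
      unfolding hitting_time_def by (simp only: image_empty Inf_empty top_ereal_def)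
    with fin show False ..
  qed
  have bdd: "bdd_below ?A" by (auto intro!: bdd_belowI[of _ 0])
  define t where "t = Inf ?A"
  have eq: "hitting_time X c \<omega> = ereal t"
    unfolding hitting_time_def t_def using ereal_Inf'[OF bdd ne] by simp
  have t0: "0 \<le> t" unfolding t_def using ne by (intro cInf_greatest) auto
  obtain \<eta> where \<eta>: "0 < \<eta>" "\<And>s. t \<le> s \<Longrightarrow> s < t + \<eta> \<Longrightarrow> X s \<omega> = X t \<omega>"
    using right_continuous_discrete[OF rc[OF t0]] by auto
  have "Inf ?A < t + \<eta>" using \<eta>(1) by (simp add: t_def)
  then obtain s where s: "s \<in> ?A" "s < t + \<eta>"
    using cInf_lessD[OF ne] by blast
  have low: "t \<le> r" if "r \<in> ?A" for r
    unfolding t_def using that bdd by (rule cInf_lower)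
  have "X t \<omega> = c" using \<eta>(2)[OF low[OF s(1)] s(2)] s(1) by simp
  moreover have "X r \<omega> \<noteq> c" if "0 \<le> r" "r < t" for r
    using low[of r] that by auto
  ultimately show ?thesis using t0 eq by blast
qed

text \<open>A visit lasts for a nondegenerate interval and so includes a rational time; the strict
  inequality leaves room for it. This makes the event a countable union, as measurability
  requires.\<close>

lemma hitting_time_less_iff:
  assumes rc: "\<And>t. 0 \<le> t \<Longrightarrow> continuous (at_right t) (\<lambda>s. X s \<omega>)"
  shows "hitting_time X c \<omega> < y \<longleftrightarrow> (\<exists>r\<in>{r\<in>\<rat>. 0 \<le> r \<and> ereal r < y}. X r \<omega> = c)"
proof
  assume less: "hitting_time X c \<omega> < y"
  then have "hitting_time X c \<omega> \<noteq> \<infinity>" by auto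
  then obtain s where s: "0 \<le> s" "hitting_time X c \<omega> = ereal s" "X s \<omega> = c"
    using hitting_time_attained[of X \<omega>, OF rc] by blast
  obtain \<eta> where \<eta>: "0 < \<eta>" "\<And>r. s \<le> r \<Longrightarrow> r < s + \<eta> \<Longrightarrow> X r \<omega> = X s \<omega>"
    using right_continuous_discrete[OF rc[OF s(1)]] by auto
  have "ereal s < min y (ereal (s + \<eta>))" using less s \<eta>(1) by simp
  then obtain z where z: "ereal s < ereal z" "ereal z < min y (ereal (s + \<eta>))"
    using ereal_dense2 by blast
  then obtain r where r: "r \<in> \<rat>" "s < r" "r < z"
    using Rats_dense_in_real[of s z] by auto
  have "ereal r < y" using r z by (metis less_ereal.simps(1) less_trans min_less_iff_conj)
  moreover have "X r \<omega> = c" using \<eta>(2)[of r] r z s by auto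
  ultimately show "\<exists>r\<in>{r\<in>\<rat>. 0 \<le> r \<and> ereal r < y}. X r \<omega> = c" using r s by auto
next
  assume "\<exists>r\<in>{r\<in>\<rat>. 0 \<le> r \<and> ereal r < y}. X r \<omega> = c"
  then show "hitting_time X c \<omega> < y"
    unfolding hitting_time_def by (auto simp: INF_less_iff)
qed

lemma borel_measurable_hitting_time:
  assumes rc: "\<And>\<omega> t. \<omega> \<in> space M \<Longrightarrow> 0 \<le> t \<Longrightarrow> continuous (at_right t) (\<lambda>s. X s \<omega>)"
    and meas: "\<And>t. 0 \<le> t \<Longrightarrow> X t \<in> measurable M (count_space S)"
  shows "hitting_time X c \<in> borel_measurable M"
proof (rule borel_measurableI_less)
  fix y
  have "{\<omega> \<in> space M. hitting_time X c \<omega> < y} =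
      (\<Union>r\<in>{r\<in>\<rat>. 0 \<le> r \<and> ereal r < y}. {\<omega> \<in> space M. X r \<omega> = c})"
    using hitting_time_less_iff[of X, OF rc] by blast
  moreover have "{\<omega> \<in> space M. X r \<omega> = c} \<in> sets M" if "0 \<le> r" for r
  proof -
    have "X r -` ({c} \<inter> S) \<inter> space M \<in> sets M"
      by (rule measurable_sets[OF meas[OF that]]) auto
    moreover have "X r -` ({c} \<inter> S) \<inter> space M = {\<omega> \<in> space M. X r \<omega> = c}"
      using measurable_space[OF meas[OF that]] by auto
    ultimately show ?thesis by simp
  qed
  ultimately show "{\<omega> \<in> space M. hitting_time X c \<omega> < y} \<in> sets M"
    by (auto intro!: sets.countable_UN' countable_subset[OF _ countable_rat])
qed

lemma grid_first_visit:
  fixes x :: "real \<Rightarrow> nat"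
  assumes rc: "continuous (at_right r) x" and r: "0 \<le> r" "x r = c" "\<And>s. 0 \<le> s \<Longrightarrow> s < r \<Longrightarrow> x s \<noteq> c"
    and t: "r \<le> t" "0 < t"
  shows "\<exists>k. (\<forall>n. k n \<le> n) \<and> (\<lambda>n. real (k n) * t / real n) \<longlonglongrightarrow> r \<and>
    eventually (\<lambda>n. \<forall>j. (x (real j * t / real n) = c \<and> (\<forall>i<j. x (real i * t / real n) \<noteq> c)) \<longleftrightarrow> j = k n) sequentially"
proof -
  \<comment> \<open>The index of the first grid point not before r. Once the mesh is shorter than
    the holding interval after r, the path is still at c there.\<close>
  define k where "k n = nat \<lceil>real n * r / t\<rceil>" for n
  have lo: "real n * r / t \<le> real (k n)" and hi: "real (k n) < real n * r / t + 1" for n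
    using r t unfolding k_def by (auto simp: of_nat_nat ceiling_correct) linarith
  have kr: "r \<le> real (k n) * t / real n" "real (k n) * t / real n < r + t / real n" if "0 < n" for n
    using lo[of n] hi[of n] that t by (auto simp: field_simps)
  have k_le: "k n \<le> n" for n
  proof -
    have "real n * r / t \<le> real n" using t by (simp add: divide_le_eq mult_left_mono)
    then show ?thesis unfolding k_def by (simp add: nat_le_iff ceiling_le_iff)
  qed
  have k_lim: "(\<lambda>n. real (k n) * t / real n) \<longlonglongrightarrow> r"
  proof (rule tendsto_sandwich[where f = "\<lambda>_. r" and h = "\<lambda>n. r + t / real n"])
    show "\<forall>\<^sub>F n in sequentially. r \<le> real (k n) * t / real n"
      using eventually_gt_at_top[of 0] by eventually_elim (rule kr)
    show "\<forall>\<^sub>F n in sequentially. real (k n) * t / real n \<le> r + t / real n"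
      using eventually_gt_at_top[of 0] by eventually_elim (use kr in \<open>auto intro: less_imp_le\<close>)
    show "(\<lambda>n. r + t / real n) \<longlonglongrightarrow> r"
      using tendsto_add[OF tendsto_const lim_const_over_n[of t]] by simp
  qed simp
  obtain \<eta> where \<eta>: "0 < \<eta>" "\<And>s. r \<le> s \<Longrightarrow> s < r + \<eta> \<Longrightarrow> x s = x r"
    using right_continuous_discrete[OF rc] by auto
  have "eventually (\<lambda>n. t / real n < \<eta>) sequentially"
    using order_tendstoD(2)[OF lim_const_over_n[of t] \<eta>(1)] by simp
  then have "eventually (\<lambda>n. \<forall>j. (x (real j * t / real n) = c \<and> (\<forall>i<j. x (real i * t / real n) \<noteq> c)) \<longleftrightarrow> j = k n) sequentially"
    using eventually_gt_at_top[of 0]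
  proof eventually_elim
    case (elim n)
    have hit: "x (real (k n) * t / real n) = c"
      using \<eta>(2)[OF kr(1)] kr(2)[of n] elim r by auto
    have "x (real i * t / real n) \<noteq> c" if "i < k n" for i
    proof (rule r(3))
      have "real i < real n * r / t"
        using that r t unfolding k_def by (simp add: zless_nat_eq_int_zless less_ceiling_iff)
      then show "real i * t / real n < r" using elim t by (simp add: field_simps)
    qed (use t in auto)
    with hit show ?case by (metis linorder_neqE_nat)
  qed
  with k_le k_lim show ?thesis by blast
qed

subsection \<open>First passage decomposition\<close>

lemma markov_jump_processD:
  assumes "markov_jump_process M S q X"
  shows "prob_space M" "finite S"
    and "\<And>t. 0 \<le> t \<Longrightarrow> X t \<in> measurable M (count_space S)"
    and "\<And>\<omega> t. \<omega> \<in> space M \<Longrightarrow> 0 \<le> t \<Longrightarrow> continuous (at_right t) (\<lambda>s. X s \<omega>)"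
  using assms by (auto simp: markov_jump_process_def)

text \<open>Unlike the conditional probabilities, the products make sense for null events too.\<close>

lemma markov_jump_process_transition:
  assumes "markov_jump_process M S q X"
  shows "\<exists>p. transition_function S q p \<and>
    (\<forall>n t x. \<forall>y\<in>S. 0 \<le> t 0 \<longrightarrow> (\<forall>i\<le>n. t i < t (Suc i)) \<longrightarrow>
      \<P>(\<omega> in M. X (t (Suc n)) \<omega> = y \<and> (\<forall>i\<le>n. X (t i) \<omega> = x i))
        = \<P>(\<omega> in M. \<forall>i\<le>n. X (t i) \<omega> = x i) * p (t (Suc n) - t n) (x n) y)"
proof -
  from assms obtain p where p: "transition_function S q p"
    and cond: "\<forall>n t x. \<forall>y\<in>S. 0 \<le> t 0 \<longrightarrow> (\<forall>i\<le>n. t i < t (Suc i)) \<longrightarrow>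
        \<P>(\<omega> in M. \<forall>i\<le>n. X (t i) \<omega> = x i) \<noteq> 0 \<longrightarrow>
        \<P>(\<omega> in M. X (t (Suc n)) \<omega> = y \<bar> \<forall>i\<le>n. X (t i) \<omega> = x i)
          = p (t (Suc n) - t n) (x n) y"
    unfolding markov_jump_process_def by (elim conjE exE) (rule that)
  note meas = markov_jump_processD(3)[OF assms]
  interpret prob_space M
    by (rule markov_jump_processD(1)[OF assms])
  show ?thesis
  proof (intro exI[of _ p] conjI allI ballI impI p)
    fix n :: nat and t :: "nat \<Rightarrow> real" and x y
    assume y: "y \<in> S" and t: "0 \<le> t 0" "\<forall>i\<le>n. t i < t (Suc i)"
    show "\<P>(\<omega> in M. X (t (Suc n)) \<omega> = y \<and> (\<forall>i\<le>n. X (t i) \<omega> = x i))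
        = \<P>(\<omega> in M. \<forall>i\<le>n. X (t i) \<omega> = x i) * p (t (Suc n) - t n) (x n) y"
    proof (cases "\<P>(\<omega> in M. \<forall>i\<le>n. X (t i) \<omega> = x i) = 0")
      case True
      have t0: "0 \<le> t i" if "i \<le> n" for i
        using that
      proof (induction i)
        case (Suc i)
        then show ?case using t(2)[rule_format, of i] by simp
      qed (use t in simp)
      have "Measurable.pred M (\<lambda>\<omega>. X (t i) \<omega> = x i)" if "i \<le> n" for i
        using meas[OF t0[OF that]] by measurable
      then have sets: "{\<omega> \<in> space M. \<forall>i\<le>n. X (t i) \<omega> = x i} \<in> sets M"
        by measurable
      have "\<P>(\<omega> in M. X (t (Suc n)) \<omega> = y \<and> (\<forall>i\<le>n. X (t i) \<omega> = x i))
          \<le> \<P>(\<omega> in M. \<forall>i\<le>n. X (t i) \<omega> = x i)"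
        by (rule finite_measure_mono[OF _ sets]) blast
      then have "\<P>(\<omega> in M. X (t (Suc n)) \<omega> = y \<and> (\<forall>i\<le>n. X (t i) \<omega> = x i)) = 0"
        unfolding True by (rule antisym) (rule measure_nonneg)
      then show ?thesis unfolding True by (simp only: mult_zero_left)
    next
      case False
      with cond y t have "\<P>(\<omega> in M. X (t (Suc n)) \<omega> = y \<bar> \<forall>i\<le>n. X (t i) \<omega> = x i)
            = p (t (Suc n) - t n) (x n) y"
        by blast
      with False show ?thesis
        by (simp add: cond_prob_def field_simps)
    qed
  qed
qed

locale markov_jump = prob_space M for M :: "'a measure" +
  fixes S :: "nat set" and q :: "nat \<Rightarrow> nat \<Rightarrow> real" and X :: "real \<Rightarrow> 'a \<Rightarrow> nat"
    and p :: "real \<Rightarrow> nat \<Rightarrow> nat \<Rightarrow> real"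
  assumes finite_states: "finite S"
    and measurable_state: "\<And>t. 0 \<le> t \<Longrightarrow> X t \<in> measurable M (count_space S)"
    and right_continuous: "\<And>\<omega> t. \<omega> \<in> space M \<Longrightarrow> 0 \<le> t \<Longrightarrow> continuous (at_right t) (\<lambda>s. X s \<omega>)"
    and transition: "transition_function S q p"
    and markov: "\<And>n t x y. y \<in> S \<Longrightarrow> 0 \<le> t 0 \<Longrightarrow> \<forall>i\<le>n. t i < t (Suc i) \<Longrightarrow>
      \<P>(\<omega> in M. X (t (Suc n)) \<omega> = y \<and> (\<forall>i\<le>n. X (t i) \<omega> = x i))
        = \<P>(\<omega> in M. \<forall>i\<le>n. X (t i) \<omega> = x i) * p (t (Suc n) - t n) (x n) y"

lemma markov_jump_process_imp_markov_jump:
  assumes "markov_jump_process M S q X"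
  shows "\<exists>p. markov_jump M S q X p"
proof -
  obtain p where p: "transition_function S q p"
    and m: "\<forall>n t x. \<forall>y\<in>S. 0 \<le> t 0 \<longrightarrow> (\<forall>i\<le>n. t i < t (Suc i)) \<longrightarrow>
      \<P>(\<omega> in M. X (t (Suc n)) \<omega> = y \<and> (\<forall>i\<le>n. X (t i) \<omega> = x i))
        = \<P>(\<omega> in M. \<forall>i\<le>n. X (t i) \<omega> = x i) * p (t (Suc n) - t n) (x n) y"
    using markov_jump_process_transition[OF assms] by (elim exE conjE) (rule that)
  have "markov_jump M S q X p"
    unfolding markov_jump_def markov_jump_axioms_def
  proof (intro conjI allI impI)
    show "prob_space M" "finite S"
      by (rule markov_jump_processD[OF assms])+
    show "X t \<in> measurable M (count_space S)" if "0 \<le> t" for t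
      by (rule markov_jump_processD(3)[OF assms that])
    show "continuous (at_right t) (\<lambda>s. X s \<omega>)" if "\<omega> \<in> space M" "0 \<le> t" for \<omega> t
      by (rule markov_jump_processD(4)[OF assms that])
    show "transition_function S q p" by (rule p)
    show "\<P>(\<omega> in M. X (t (Suc n)) \<omega> = y \<and> (\<forall>i\<le>n. X (t i) \<omega> = x i))
        = \<P>(\<omega> in M. \<forall>i\<le>n. X (t i) \<omega> = x i) * p (t (Suc n) - t n) (x n) y"
      if "y \<in> S" "0 \<le> t 0" "\<forall>i\<le>n. t i < t (Suc i)" for n t x y
      using m that by blast
  qed
  then show ?thesis by blast
qed

context markov_jump
begin

lemma pred_state [measurable]: "0 \<le> t \<Longrightarrow> Measurable.pred M (\<lambda>\<omega>. X t \<omega> = c)"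
  using measurable_state[of t] by measurable

text \<open>A first visit at \<open>t n\<close> does not prescribe the earlier states, but it splits
  into finitely many disjoint path events, all of which end in c and share the same transition
  factor.\<close>

lemma first_passage_markov:
  assumes c: "c \<in> S" and y: "y \<in> S" and t: "0 \<le> t 0" "\<forall>i\<le>n. t i < t (Suc i)"
  shows "\<P>(\<omega> in M. X (t (Suc n)) \<omega> = y \<and> X (t n) \<omega> = c \<and> (\<forall>i<n. X (t i) \<omega> \<noteq> c))
    = \<P>(\<omega> in M. X (t n) \<omega> = c \<and> (\<forall>i<n. X (t i) \<omega> \<noteq> c)) * p (t (Suc n) - t n) c y"
proof -
  \<comment> \<open>Extensional functions: there are only finitely many, and distinct ones differ at
    an index up to n, which makes the path events disjoint.\<close>
  define I where "I = {x \<in> PiE {..n} (\<lambda>_. S). x n = c \<and> (\<forall>i<n. x i \<noteq> c)}"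
  define F where "F x = {\<omega> \<in> space M. \<forall>i\<le>n. X (t i) \<omega> = x i}" for x
  define G where "G x = {\<omega> \<in> space M. X (t (Suc n)) \<omega> = y \<and> (\<forall>i\<le>n. X (t i) \<omega> = x i)}" for x
  have t0: "0 \<le> t i" if "i \<le> Suc n" for i
    using that
  proof (induction i)
    case (Suc i)
    then show ?case using t(2)[rule_format, of i] by simp
  qed (use t in simp)
  have finI: "finite I"
    unfolding I_def by (rule finite_subset[OF _ finite_PiE[of "{..n}" "\<lambda>_. S"]]) (auto simp: finite_states)
  have F_sets: "F x \<in> events" and G_sets: "G x \<in> events" for x
    unfolding F_def G_def using t0 by measurable
  have disj: "disjoint_family_on F I"
    unfolding disjoint_family_on_def
  proof (intro ballI impI)
    fix x x' assume "x \<in> I" "x' \<in> I" "x \<noteq> x'"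
    then obtain i where "i \<le> n" "x i \<noteq> x' i"
      unfolding I_def by (metis (no_types, lifting) PiE_ext atMost_iff mem_Collect_eq)
    then show "F x \<inter> F x' = {}" unfolding F_def by force
  qed
  have "G x \<subseteq> F x" for x unfolding F_def G_def by blast
  then have disjG: "disjoint_family_on G I"
    using disj unfolding disjoint_family_on_def by blast
  have path: "\<exists>x\<in>I. \<forall>i\<le>n. X (t i) \<omega> = x i"
    if "\<omega> \<in> space M" "X (t n) \<omega> = c" "\<forall>i<n. X (t i) \<omega> \<noteq> c" for \<omega>
  proof (rule bexI)
    show "(\<lambda>i\<in>{..n}. X (t i) \<omega>) \<in> I"
      using that measurable_space[OF measurable_state[OF t0]] by (auto simp: I_def)
  qed simp
  have UF: "{\<omega> \<in> space M. X (t n) \<omega> = c \<and> (\<forall>i<n. X (t i) \<omega> \<noteq> c)} = (\<Union>x\<in>I. F x)"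
  proof (intro equalityI subsetI)
    fix \<omega> assume "\<omega> \<in> {\<omega> \<in> space M. X (t n) \<omega> = c \<and> (\<forall>i<n. X (t i) \<omega> \<noteq> c)}"
    then show "\<omega> \<in> (\<Union>x\<in>I. F x)" using path[of \<omega>] by (auto simp: F_def)
  qed (auto simp: F_def I_def)
  have UG: "{\<omega> \<in> space M. X (t (Suc n)) \<omega> = y \<and> X (t n) \<omega> = c \<and> (\<forall>i<n. X (t i) \<omega> \<noteq> c)} = (\<Union>x\<in>I. G x)"
  proof (intro equalityI subsetI)
    fix \<omega> assume "\<omega> \<in> {\<omega> \<in> space M. X (t (Suc n)) \<omega> = y \<and> X (t n) \<omega> = c \<and> (\<forall>i<n. X (t i) \<omega> \<noteq> c)}"
    then show "\<omega> \<in> (\<Union>x\<in>I. G x)" using path[of \<omega>] by (auto simp: G_def)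
  qed (auto simp: G_def I_def)
  have "prob (\<Union>x\<in>I. G x) = (\<Sum>x\<in>I. prob (G x))"
    using G_sets by (intro finite_measure_finite_Union[OF finI _ disjG]) auto
  also have "\<dots> = (\<Sum>x\<in>I. prob (F x) * p (t (Suc n) - t n) c y)"
  proof (rule sum.cong[OF refl])
    fix x assume "x \<in> I"
    then have "x n = c" by (simp add: I_def)
    then show "prob (G x) = prob (F x) * p (t (Suc n) - t n) c y"
      using markov[OF y t, of x] unfolding F_def G_def by simp
  qed
  also have "\<dots> = prob (\<Union>x\<in>I. F x) * p (t (Suc n) - t n) c y"
    using F_sets by (simp add: finite_measure_finite_Union[OF finI _ disj] image_subset_iff sum_distrib_right)
  finally show ?thesis unfolding UF UG .
qed

lemma hitting_time_measurable [measurable]: "hitting_time X c \<in> borel_measurable M"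
  by (rule borel_measurable_hitting_time[OF right_continuous measurable_state])

text \<open>
  Decompose along the first visit to \<open>c\<close> on the grid of mesh \<open>t / n\<close>, where only the Markov
  property at deterministic times is needed, and let \<open>n \<rightarrow> \<infinity>\<close>.
\<close>

theorem first_passage_decomposition:
  assumes c: "c \<in> S" and t: "0 < t"
  shows "\<P>(\<omega> in M. X t \<omega> = c) =
    (\<integral>\<omega>. (if hitting_time X c \<omega> \<le> ereal t then p (t - real_of_ereal (hitting_time X c \<omega>)) c c else 0) \<partial>M)"
proof -
  \<comment> \<open>\<open>V n \<omega> j\<close> says that j is the index of the first visited grid
    point. \<open>Y n\<close> is the integrand of the claim with the hitting time replaced by this
    grid time.\<close>
  define V where "V n \<omega> j \<longleftrightarrow> X (real j * t / real n) \<omega> = c \<and> (\<forall>i<j. X (real i * t / real n) \<omega> \<noteq> c)" for n j :: nat and \<omega>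
  define Y where "Y n \<omega> = (\<Sum>j\<le>n. if V n \<omega> j then p (t - real j * t / real n) c c else 0)" for n \<omega>
  let ?f = "\<lambda>\<omega>. if hitting_time X c \<omega> \<le> ereal t then p (t - real_of_ereal (hitting_time X c \<omega>)) c c else 0"
  have [measurable]: "Measurable.pred M (\<lambda>\<omega>. X (real i * t / real n) \<omega> = c)" for i n :: nat
    using t by (intro pred_state) auto
  have V_meas [measurable]: "Measurable.pred M (\<lambda>\<omega>. V n \<omega> j)" for n j
    unfolding V_def by measurable
  have Y_meas: "Y n \<in> borel_measurable M" for n
    unfolding Y_def by measurable
  have V_unique: "j = k" if "V n \<omega> j" "V n \<omega> k" for n \<omega> j k
    using that unfolding V_def by (metis linorder_neqE_nat)
  have Y_eq: "Y n \<omega> = p (t - real k * t / real n) c c" if "V n \<omega> k" "k \<le> n" for n \<omega> k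
  proof -
    have "V n \<omega> j \<longleftrightarrow> j = k" for j using V_unique that by blast
    then show ?thesis using that by (simp add: Y_def)
  qed
  have Y_0: "Y n \<omega> = 0" if "\<And>k. k \<le> n \<Longrightarrow> \<not> V n \<omega> k" for n \<omega>
    using that by (simp add: Y_def)
  have p01: "0 \<le> p s c c" "p s c c \<le> 1" if "0 \<le> s" for s
    using transition_function_le_1[OF transition finite_states that c c] transition c that
    by (auto simp: transition_function_def)
  have grid: "real k * t / real n \<le> t" if "k \<le> n" for k n
    using that t by (cases "n = 0") (auto simp: divide_le_eq mult_right_mono)
  have Y_bound: "norm (Y n \<omega>) \<le> 1" for n \<omega>
  proof (cases "\<exists>k\<le>n. V n \<omega> k")
    case True
    then obtain k where k: "k \<le> n" "V n \<omega> k" by blast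
    then show ?thesis using Y_eq[OF k(2,1)] p01[of "t - real k * t / real n"] grid[OF k(1)] by simp
  qed (use Y_0 in auto)
  have lim: "(\<lambda>n. Y n \<omega>) \<longlonglongrightarrow> ?f \<omega>" if \<omega>: "\<omega> \<in> space M" for \<omega>
  proof (cases "hitting_time X c \<omega> \<le> ereal t")
    case True
    then have "hitting_time X c \<omega> \<noteq> \<infinity>" by auto
    then obtain r where r: "0 \<le> r" "hitting_time X c \<omega> = ereal r" "X r \<omega> = c"
      "\<And>s. 0 \<le> s \<Longrightarrow> s < r \<Longrightarrow> X s \<omega> \<noteq> c"
      using hitting_time_attained[of X \<omega>, OF right_continuous[OF \<omega>]] by blast
    then have rt: "r \<le> t" using True by simp
    obtain k where k: "\<And>n. k n \<le> n" "(\<lambda>n. real (k n) * t / real n) \<longlonglongrightarrow> r"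
      "eventually (\<lambda>n. \<forall>j. V n \<omega> j \<longleftrightarrow> j = k n) sequentially"
      using grid_first_visit[where x = "\<lambda>s. X s \<omega>", OF right_continuous[OF \<omega> r(1)] r(1,3,4) rt t]
      unfolding V_def by blast
    have "(\<lambda>n. p (t - real (k n) * t / real n) c c) \<longlonglongrightarrow> p (t - r) c c"
    proof (rule continuous_on_tendsto_compose[OF transition_function_continuous_on[OF transition finite_states c c]])
      show "(\<lambda>n. t - real (k n) * t / real n) \<longlonglongrightarrow> t - r"
        by (intro tendsto_intros k)
    qed (use rt grid[OF k(1)] in auto)
    moreover have "eventually (\<lambda>n. p (t - real (k n) * t / real n) c c = Y n \<omega>) sequentially"
      using k(3) by eventually_elim (use Y_eq k(1) in auto)
    ultimately have "(\<lambda>n. Y n \<omega>) \<longlonglongrightarrow> p (t - r) c c"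
      by (rule Lim_transform_eventually)
    then show ?thesis using True r(2) by simp
  next
    case False
    have "\<not> V n \<omega> k" if "k \<le> n" for n k
    proof
      assume "V n \<omega> k"
      then have "hitting_time X c \<omega> \<le> ereal (real k * t / real n)"
        unfolding hitting_time_def V_def using t by (intro INF_lower) auto
      also have "\<dots> \<le> ereal t" using grid[OF that] by simp
      finally show False using False by simp
    qed
    then have "Y n \<omega> = 0" for n using Y_0 by blast
    then show ?thesis using False by simp
  qed
  have f_meas: "?f \<in> borel_measurable M"
    by (rule borel_measurable_LIMSEQ_real[OF lim Y_meas])
  have "(\<lambda>n. expectation (Y n)) \<longlonglongrightarrow> expectation ?f"
    by (rule integral_dominated_convergence[where w = "\<lambda>_. 1"])
      (use f_meas Y_meas lim Y_bound in auto)
  moreover have "expectation (Y n) = \<P>(\<omega> in M. X t \<omega> = c)" if n: "0 < n" for n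
  proof -
    have "expectation (Y n) = (\<Sum>j\<le>n. expectation (\<lambda>\<omega>. p (t - real j * t / real n) c c * indicator {\<omega> \<in> space M. V n \<omega> j} \<omega>))"
      (is "_ = (\<Sum>j\<le>n. expectation (?h j))")
    proof -
      have "expectation (Y n) = expectation (\<lambda>\<omega>. \<Sum>j\<le>n. ?h j \<omega>)"
        unfolding Y_def by (intro Bochner_Integration.integral_cong[OF refl] sum.cong[OF refl]) simp
      also have "\<dots> = (\<Sum>j\<le>n. expectation (?h j))"
        by (rule Bochner_Integration.integral_sum) (simp add: emeasure_eq_measure)
      finally show ?thesis .
    qed
    also have "\<dots> = (\<Sum>j\<le>n. \<P>(\<omega> in M. V n \<omega> j) * p (t - real j * t / real n) c c)"
      by (simp add: mult.commute Int_def cong: conj_cong)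
    also have "\<dots> = (\<Sum>j\<le>n. \<P>(\<omega> in M. X t \<omega> = c \<and> V n \<omega> j))"
    proof (rule sum.cong[OF refl])
      fix j assume "j \<in> {..n}"
      then have j: "j \<le> n" by simp
      show "\<P>(\<omega> in M. V n \<omega> j) * p (t - real j * t / real n) c c = \<P>(\<omega> in M. X t \<omega> = c \<and> V n \<omega> j)"
      proof (cases "j = n")
        \<comment> \<open>A first grid visit at time t itself leaves no later time for the Markov
          property; the factor is \<open>p 0 c c\<close> = 1.\<close>
        case True
        have "p 0 c c = 1" using transition c by (simp add: transition_function_def)
        moreover have "(X t \<omega> = c \<and> V n \<omega> j) = V n \<omega> j" for \<omega>
          using True n by (auto simp: V_def)
        ultimately show ?thesis using True n by simp
      next
        case False
        then have jn: "real j * t / real n < t" using j t n by (simp add: divide_less_eq)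
        \<comment> \<open>The grid up to index j, followed directly by t; the grid points in between
          are skipped.\<close>
        define T where "T i = (if i \<le> j then real i * t / real n else t)" for i
        have "\<P>(\<omega> in M. X (T (Suc j)) \<omega> = c \<and> X (T j) \<omega> = c \<and> (\<forall>i<j. X (T i) \<omega> \<noteq> c))
            = \<P>(\<omega> in M. X (T j) \<omega> = c \<and> (\<forall>i<j. X (T i) \<omega> \<noteq> c)) * p (T (Suc j) - T j) c c"
          using jn t n by (intro first_passage_markov c) (auto simp: T_def le_less Suc_le_eq divide_strict_right_mono)
        then show ?thesis by (simp add: T_def V_def cong: conj_cong)
      qed
    qed
    also have "\<dots> = prob (\<Union>j\<in>{..n}. {\<omega> \<in> space M. X t \<omega> = c \<and> V n \<omega> j})"
    proof (rule finite_measure_finite_Union[symmetric])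
      show "(\<lambda>j. {\<omega> \<in> space M. X t \<omega> = c \<and> V n \<omega> j}) ` {..n} \<subseteq> events"
        using t by auto
      show "disjoint_family_on (\<lambda>j. {\<omega> \<in> space M. X t \<omega> = c \<and> V n \<omega> j}) {..n}"
        unfolding disjoint_family_on_def using V_unique by blast
    qed simp
    \<comment> \<open>The last grid point is t, so on this event some grid point is visited and
      there is a least one.\<close>
    also have "(\<Union>j\<in>{..n}. {\<omega> \<in> space M. X t \<omega> = c \<and> V n \<omega> j}) = {\<omega> \<in> space M. X t \<omega> = c}"
    proof (intro equalityI subsetI)
      fix \<omega> assume \<omega>: "\<omega> \<in> {\<omega> \<in> space M. X t \<omega> = c}"
      let ?P = "\<lambda>j. X (real j * t / real n) \<omega> = c"
      have Pn: "?P n" using \<omega> n by simp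
      then have "V n \<omega> (Least ?P)" unfolding V_def by (metis (mono_tags, lifting) LeastI not_less_Least)
      moreover have "Least ?P \<le> n" using Pn by (rule Least_le)
      ultimately show "\<omega> \<in> (\<Union>j\<in>{..n}. {\<omega> \<in> space M. X t \<omega> = c \<and> V n \<omega> j})" using \<omega> by auto
    qed auto
    finally show ?thesis .
  qed
  then have "eventually (\<lambda>n. \<P>(\<omega> in M. X t \<omega> = c) = expectation (Y n)) sequentially"
    by (intro eventually_mono[OF eventually_gt_at_top[of 0]]) simp
  then have "(\<lambda>n. expectation (Y n)) \<longlonglongrightarrow> \<P>(\<omega> in M. X t \<omega> = c)"
    by (rule Lim_transform_eventually[OF tendsto_const])
  ultimately show ?thesis using LIMSEQ_unique by blast
qed

lemma state_probability:
  assumes x: "x \<in> S" and y: "y \<in> S" and start: "AE \<omega> in M. X 0 \<omega> = x" and t: "0 < t"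
  shows "\<P>(\<omega> in M. X t \<omega> = y) = p t x y"
proof -
  have 1: "\<P>(\<omega> in M. X 0 \<omega> = x) = 1"
    using start by (intro prob_eq_1[THEN iffD2]) auto
  have "\<P>(\<omega> in M. X t \<omega> = y) = \<P>(\<omega> in M. X t \<omega> = y \<and> X 0 \<omega> = x)"
    using start t by (intro prob_eq_AE) auto
  also have "\<dots> = p t x y"
    using markov[OF y, of "\<lambda>i. real i * t" 0 "\<lambda>_. x"] t 1 by simp
  finally show ?thesis .
qed

end

subsection \<open>Antiderivatives of powers of a decaying exponential\<close>

text \<open>With b = \<kappa> + \<rho> * exp (- u), factor b ^ N - \<kappa> ^ N as (b - \<kappa>)
  times a sum of monomials. Since b - \<kappa> is minus the derivative of b, each term has a power
  of b as primitive. For \<kappa> = \<nu>, the choices \<rho> = \<mu> and \<rho> = - \<nu> give the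
  transition probabilities into the full state from the full and the empty one.\<close>

definition decay_power_primitive :: "real \<Rightarrow> real \<Rightarrow> nat \<Rightarrow> real \<Rightarrow> real" where
  "decay_power_primitive \<kappa> \<rho> N s = \<kappa> ^ N * s +
    (\<Sum>i<N. \<kappa> ^ (N - Suc i) * ((\<kappa> + \<rho>) ^ Suc i - (\<kappa> + \<rho> * exp (- s)) ^ Suc i) / real (Suc i))"

lemma decay_power_primitive_0 [simp]: "decay_power_primitive \<kappa> \<rho> N 0 = 0"
  by (simp add: decay_power_primitive_def)

lemma DERIV_decay_power_primitive:
  "(decay_power_primitive \<kappa> \<rho> N has_real_derivative (\<kappa> + \<rho> * exp (- s)) ^ N) (at s)"
proof -
  let ?b = "\<kappa> + \<rho> * exp (- s)"
  have "((\<lambda>s. \<kappa> ^ (N - Suc i) * ((\<kappa> + \<rho>) ^ Suc i - (\<kappa> + \<rho> * exp (- s)) ^ Suc i) / real (Suc i))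
      has_real_derivative (?b - \<kappa>) * (\<kappa> ^ (N - Suc i) * ?b ^ i)) (at s)" for i
    by (rule derivative_eq_intros refl | simp)+
  then have "(decay_power_primitive \<kappa> \<rho> N has_real_derivative
      \<kappa> ^ N * 1 + (\<Sum>i<N. (?b - \<kappa>) * (\<kappa> ^ (N - Suc i) * ?b ^ i))) (at s)"
    unfolding decay_power_primitive_def
    by (intro DERIV_add DERIV_sum DERIV_cmult DERIV_ident) auto
  moreover have "\<kappa> ^ N * 1 + (\<Sum>i<N. (?b - \<kappa>) * (\<kappa> ^ (N - Suc i) * ?b ^ i)) = ?b ^ N"
    using power_diff_sumr2[of ?b N \<kappa>] by (simp add: sum_distrib_left)
  ultimately show ?thesis by simp
qed

lemma decay_nonneg:
  fixes \<kappa> \<rho> s :: real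
  assumes "0 \<le> \<kappa>" "0 \<le> \<kappa> + \<rho>" "0 \<le> s"
  shows "0 \<le> \<kappa> + \<rho> * exp (- s)"
proof -
  have "0 \<le> (1 - exp (- s)) * \<kappa> + exp (- s) * (\<kappa> + \<rho>)"
    by (rule add_nonneg_nonneg[OF mult_nonneg_nonneg mult_nonneg_nonneg]) (use assms in auto)
  also have "\<dots> = \<kappa> + \<rho> * exp (- s)"
    by (simp add: algebra_simps)
  finally show ?thesis .
qed

lemma decay_power_primitive_nonneg:
  assumes "0 \<le> \<kappa>" "0 \<le> \<kappa> + \<rho>" "0 \<le> s"
  shows "0 \<le> decay_power_primitive \<kappa> \<rho> N s"
proof -
  have "decay_power_primitive \<kappa> \<rho> N 0 \<le> decay_power_primitive \<kappa> \<rho> N s"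
  proof (rule DERIV_nonneg_imp_nondecreasing[OF assms(3)])
    fix x assume "0 \<le> x" "x \<le> s"
    then show "\<exists>y. (decay_power_primitive \<kappa> \<rho> N has_real_derivative y) (at x) \<and> 0 \<le> y"
      using DERIV_decay_power_primitive decay_nonneg[OF assms(1,2)] by (blast intro: zero_le_power)
  qed
  then show ?thesis by simp
qed

lemma nn_integral_decay_power:
  assumes "0 \<le> \<kappa>" "0 \<le> \<kappa> + \<rho>" "r \<le> t"
  shows "(\<integral>\<^sup>+ s. ennreal ((\<kappa> + \<rho> * exp (- (s - r))) ^ N) * indicator {r..t} s \<partial>lborel)
    = ennreal (decay_power_primitive \<kappa> \<rho> N (t - r))"
proof -
  have "(\<integral>\<^sup>+ s. ennreal ((\<kappa> + \<rho> * exp (- (s - r))) ^ N) * indicator {r..t} s \<partial>lborel)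
    = ennreal (decay_power_primitive \<kappa> \<rho> N (t - r) - decay_power_primitive \<kappa> \<rho> N (r - r))"
  proof (rule nn_integral_FTC_Icc[where F = "\<lambda>s. decay_power_primitive \<kappa> \<rho> N (s - r)"])
    fix s assume "s \<in> {r..t}"
    then have s: "r \<le> s" "s \<le> t" by auto
    have "((\<lambda>s. decay_power_primitive \<kappa> \<rho> N (s - r)) has_real_derivative (\<kappa> + \<rho> * exp (- (s - r))) ^ N * 1) (at s)"
      by (rule DERIV_chain2[OF DERIV_decay_power_primitive]) (auto intro!: derivative_eq_intros)
    then show "((\<lambda>s. decay_power_primitive \<kappa> \<rho> N (s - r)) has_real_derivative (\<kappa> + \<rho> * exp (- (s - r))) ^ N) (at s)"
      by simp
    show "0 \<le> (\<kappa> + \<rho> * exp (- (s - r))) ^ N"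
      using assms s by (intro zero_le_power decay_nonneg) auto
  qed (use assms in auto)
  then show ?thesis by simp
qed

text \<open>The value at \<open>s = \<infinity>\<close> of the sum in \<^const>\<open>decay_power_primitive\<close> corresponds to \<open>b = 0\<close>.\<close>

lemma scaled_harmonic_geometric_limit:
  fixes \<nu> b :: real
  assumes \<nu>: "0 < \<nu>" "\<nu> < 1" and b: "0 \<le> b" "b < 1"
  shows "(\<lambda>N. real N * (\<Sum>i<N. \<nu> ^ (N - Suc i) * (1 - b ^ Suc i) / real (Suc i))) \<longlonglongrightarrow> 1 / (1 - \<nu>)"
proof -
  \<comment> \<open>Reindexed by k = N - Suc i, which fixes the geometric weight and lets N / (N -
    k) tend to 1. The value 0 from k = N on turns the sums into series, for Tannery's
    theorem.\<close>
  define a where "a k N = (if k < N then \<nu> ^ k * (1 - b ^ (N - k)) * (real N / real (N - k)) else 0)" for k N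
  have lim: "(\<lambda>N. a k N) \<longlonglongrightarrow> \<nu> ^ k" for k
  proof (rule LIMSEQ_offset[of _ k])
    have "(\<lambda>n. \<nu> ^ k * (1 - b ^ n) * (1 + real k / real n)) \<longlonglongrightarrow> \<nu> ^ k * (1 - 0) * (1 + 0)"
      using b by (intro tendsto_intros LIMSEQ_realpow_zero lim_const_over_n) auto
    moreover have "eventually (\<lambda>n. \<nu> ^ k * (1 - b ^ n) * (1 + real k / real n) = a k (n + k)) sequentially"
      using eventually_gt_at_top[of 0] by eventually_elim (simp add: a_def add_divide_distrib)
    ultimately show "(\<lambda>n. a k (n + k)) \<longlonglongrightarrow> \<nu> ^ k"
      by (simp add: Lim_transform_eventually)
  qed
  have bound: "norm (a k N) \<le> real (Suc k) * \<nu> ^ k" for k N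
  proof (cases "k < N")
    case True
    \<comment> \<open>This product is the difference (k + 1) * (N - k) - N.\<close>
    have "0 \<le> real k * (real N - real k - 1)" using True by (intro mult_nonneg_nonneg) auto
    then have "real N / real (N - k) \<le> real (Suc k)"
      using True by (simp add: divide_le_eq of_nat_diff algebra_simps)
    moreover have "0 \<le> 1 - b ^ (N - k)" "1 - b ^ (N - k) \<le> 1" using b by (auto simp: power_le_one)
    ultimately have "(1 - b ^ (N - k)) * (real N / real (N - k)) \<le> 1 * real (Suc k)"
      using \<nu> by (intro mult_mono) auto
    then have "\<nu> ^ k * ((1 - b ^ (N - k)) * (real N / real (N - k))) \<le> \<nu> ^ k * real (Suc k)"
      using \<nu> by (intro mult_left_mono) auto
    moreover have "norm (a k N) = \<nu> ^ k * ((1 - b ^ (N - k)) * (real N / real (N - k)))"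
      using True \<nu> b by (simp add: a_def abs_mult power_le_one)
    ultimately show ?thesis by (simp add: mult.commute)
  qed (use \<nu> in \<open>auto simp: a_def\<close>)
  have summ: "summable (\<lambda>k. real (Suc k) * \<nu> ^ k)"
    using geometric_deriv_sums[of \<nu>] \<nu> by (auto simp: sums_iff)
  have "(\<lambda>N. \<Sum>k. a k N) \<longlonglongrightarrow> (\<Sum>k. \<nu> ^ k)"
  proof -
    have "eventually (\<lambda>(k, N). norm (a k N) \<le> real (Suc k) * \<nu> ^ k) (at_top \<times>\<^sub>F sequentially)"
      by (rule always_eventually) (use bound in blast)
    from tannerys_theorem[OF lim this summ] show ?thesis by simp
  qed
  moreover have "(\<Sum>k. \<nu> ^ k) = 1 / (1 - \<nu>)"
    using \<nu> by (simp add: suminf_geometric)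
  moreover have "(\<Sum>k. a k N) = real N * (\<Sum>i<N. \<nu> ^ (N - Suc i) * (1 - b ^ Suc i) / real (Suc i))" for N
  proof -
    have "(\<Sum>k. a k N) = (\<Sum>k<N. a k N)"
      by (rule suminf_finite) (auto simp: a_def)
    also have "\<dots> = (\<Sum>i<N. a (N - Suc i) N)"
      by (rule sum.nat_diff_reindex[symmetric])
    also have "\<dots> = (\<Sum>i<N. real N * (\<nu> ^ (N - Suc i) * (1 - b ^ Suc i) / real (Suc i)))"
    proof (rule sum.cong[OF refl])
      fix i assume "i \<in> {..<N}"
      then have "N - (N - Suc i) = Suc i" "N - Suc i < N" by auto
      then show "a (N - Suc i) N = real N * (\<nu> ^ (N - Suc i) * (1 - b ^ Suc i) / real (Suc i))"
        unfolding a_def by (simp del: of_nat_Suc power_Suc)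
    qed
    finally show ?thesis by (simp only: sum_distrib_left)
  qed
  ultimately show ?thesis by simp
qed

text \<open>As the square of N * sqrt \<nu> ^ N, the sequence reduces to the case of a linear
  factor.\<close>

lemma square_times_power_limit:
  fixes \<nu> :: real
  assumes "0 < \<nu>" "\<nu> < 1"
  shows "(\<lambda>N. (real N)\<^sup>2 * \<nu> ^ N) \<longlonglongrightarrow> 0"
proof -
  have "norm (sqrt \<nu>) < 1" using assms by simp
  then have "(\<lambda>N. (real N * sqrt \<nu> ^ N)\<^sup>2) \<longlonglongrightarrow> 0\<^sup>2"
    by (intro tendsto_power powser_times_n_limit_0)
  moreover have "(real N * sqrt \<nu> ^ N)\<^sup>2 = (real N)\<^sup>2 * \<nu> ^ N" for N
    using assms by (simp add: power_mult_distrib power_mult[symmetric] mult.commute[of _ 2])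
      (simp add: power_mult)
  ultimately show ?thesis by simp
qed

subsection \<open>Comparison with the exponential distribution function\<close>

text \<open>
  The exponential distribution function \<open>\<psi>\<close> solves \<open>\<psi> t = \<mu> * (t - \<integral>\<^bsub>0\<^esub>\<^bsup>t\<^esup> \<psi>)\<close>. An approximate
  solution \<open>\<phi>\<close> with antiderivative \<open>\<Phi>\<close> stays close to \<open>\<psi>\<close>: at an extremum of \<open>\<Phi> - \<integral>\<psi>\<close> on
  \<open>[0, t]\<close> the functions \<open>\<phi>\<close> and \<open>\<psi>\<close> almost agree, and the equation turns this into a bound on
  the extremal value.
\<close>

lemma approximate_exponential_cdf:
  fixes \<phi> \<Phi> :: "real \<Rightarrow> real"
  assumes \<mu>: "0 < \<mu>" and \<Phi>0: "\<Phi> 0 = 0"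
    and \<phi>: "\<And>t. 0 \<le> \<phi> t" "\<And>t. \<phi> t \<le> 1"
    and incr: "\<And>a b. 0 \<le> a \<Longrightarrow> a \<le> b \<Longrightarrow> (b - a) * \<phi> a \<le> \<Phi> b - \<Phi> a"
      "\<And>a b. 0 \<le> a \<Longrightarrow> a \<le> b \<Longrightarrow> \<Phi> b - \<Phi> a \<le> (b - a) * \<phi> b"
    and approx: "\<And>t. 0 \<le> t \<Longrightarrow> \<bar>\<phi> t - \<mu> * (t - \<Phi> t)\<bar> \<le> \<epsilon>"
    and t: "0 \<le> t"
  shows "\<bar>\<phi> t - (1 - exp (- \<mu> * t))\<bar> \<le> 2 * \<epsilon>"
proof -
  define \<psi> where "\<psi> s = 1 - exp (- \<mu> * s)" for s
  define \<Psi> where "\<Psi> s = s - \<psi> s / \<mu>" for s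
  have \<psi>_eq: "\<psi> s = \<mu> * (s - \<Psi> s)" for s using \<mu> by (simp add: \<Psi>_def)
  have \<epsilon>: "0 \<le> \<epsilon>" using approx[of 0] by simp
  have \<Psi>_incr: "(b - a) * \<psi> a \<le> \<Psi> b - \<Psi> a" "\<Psi> b - \<Psi> a \<le> (b - a) * \<psi> b" for a b
  proof -
    have "1 + - \<mu> * (b - a) \<le> exp (- \<mu> * (b - a))" "1 + \<mu> * (b - a) \<le> exp (\<mu> * (b - a))"
      by (rule exp_ge_add_one_self)+
    then have "(1 + - \<mu> * (b - a)) * exp (- \<mu> * a) \<le> exp (- \<mu> * (b - a)) * exp (- \<mu> * a)"
      "(1 + \<mu> * (b - a)) * exp (- \<mu> * b) \<le> exp (\<mu> * (b - a)) * exp (- \<mu> * b)"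
      by (auto intro: mult_right_mono)
    moreover have "exp (- \<mu> * (b - a)) * exp (- \<mu> * a) = exp (- \<mu> * b)"
      "exp (\<mu> * (b - a)) * exp (- \<mu> * b) = exp (- \<mu> * a)"
      by (simp_all add: exp_add[symmetric] algebra_simps)
    ultimately have "\<mu> * (b - a) - (\<psi> b - \<psi> a) \<ge> \<mu> * (b - a) * \<psi> a"
      "\<mu> * (b - a) - (\<psi> b - \<psi> a) \<le> \<mu> * (b - a) * \<psi> b"
      unfolding \<psi>_def by (simp_all add: algebra_simps)
    moreover have "\<mu> * (b - a) - (\<psi> b - \<psi> a) = \<mu> * (\<Psi> b - \<Psi> a)"
      using \<mu> by (simp add: \<Psi>_def field_simps)
    ultimately show "(b - a) * \<psi> a \<le> \<Psi> b - \<Psi> a" "\<Psi> b - \<Psi> a \<le> (b - a) * \<psi> b"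
      using \<mu> by (simp_all add: mult.assoc)
  qed
  define D where "D s = \<Phi> s - \<Psi> s" for s
  have D0: "D 0 = 0" by (simp add: D_def \<Psi>_def \<psi>_def \<Phi>0)
  \<comment> \<open>\<phi> may jump, but its bounds make \<Phi> Lipschitz, so \<open>D\<close> is
    continuous and attains its extrema.\<close>
  have lip: "1-lipschitz_on {0..t} \<Phi>"
  proof (rule lipschitz_onI)
    have *: "\<bar>\<Phi> b - \<Phi> a\<bar> \<le> b - a" if "0 \<le> a" "a \<le> b" for a b
    proof -
      have "0 \<le> (b - a) * \<phi> a" "(b - a) * \<phi> b \<le> (b - a) * 1"
        using that \<phi> by (intro mult_nonneg_nonneg mult_left_mono; simp)+
      then show ?thesis using incr[OF that] by simp
    qed
    fix x y assume "x \<in> {0..t}" "y \<in> {0..t}"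
    then show "dist (\<Phi> x) (\<Phi> y) \<le> 1 * dist x y"
      using *[of x y] *[of y x] by (cases "x \<le> y") (auto simp: dist_real_def)
  qed simp
  have \<Psi>_cont: "continuous_on A \<Psi>" and \<psi>_cont: "continuous_on A \<psi>" for A
    using \<mu> unfolding \<Psi>_def \<psi>_def by (auto intro!: continuous_intros)
  have \<Phi>_cont: "continuous_on {0..t} \<Phi>"
    by (rule lipschitz_on_continuous_on[OF lip])
  have D_cont: "continuous_on {0..t} D"
    unfolding D_def by (intro continuous_intros \<Phi>_cont \<Psi>_cont)
  have left: "(f \<longlongrightarrow> f b) (at_left b)" if "continuous_on {0..t} f" "0 < b" "b \<le> t" for f :: "real \<Rightarrow> real" and b
  proof -
    have "continuous_on {0..b} f" using that by (auto intro: continuous_on_subset)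
    then have "(f \<longlongrightarrow> f b) (at b within {0..b})" using that by (auto simp: continuous_on_def)
    then show ?thesis using that by (simp add: at_within_Icc_at_left)
  qed
  have ev: "eventually (\<lambda>a. 0 < a \<and> a < b) (at_left b)" if "0 < b" for b :: real
    using eventually_at_left_real[OF that] by eventually_elim auto
  have lower: "- (\<epsilon> / \<mu>) \<le> D s" if s: "s \<in> {0..t}" for s
  proof -
    obtain b where b: "b \<in> {0..t}" "\<And>s. s \<in> {0..t} \<Longrightarrow> D b \<le> D s"
      using continuous_attains_inf[OF compact_Icc _ D_cont] t by auto
    have "- (\<epsilon> / \<mu>) \<le> D b"
    proof (cases "b = 0")
      case True
      then show ?thesis using D0 \<epsilon> \<mu> by simp
    next
      case False
      with b have b0: "0 < b" "b \<le> t" by auto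
      \<comment> \<open>Comparing the minimum at b with a < b yields
        \<open>\<phi> a \<le> \<psi> b\<close>, so the approximate equation is used at a; continuity
        of \<Phi> then lets a tend to b.\<close>
      have "\<mu> * (b - \<Phi> b) - \<epsilon> \<le> \<psi> b"
      proof (rule tendsto_upperbound)
        show "((\<lambda>a. \<mu> * (a - \<Phi> a) - \<epsilon>) \<longlongrightarrow> \<mu> * (b - \<Phi> b) - \<epsilon>) (at_left b)"
          by (rule left[OF _ b0]) (intro continuous_intros \<Phi>_cont)
        show "\<forall>\<^sub>F a in at_left b. \<mu> * (a - \<Phi> a) - \<epsilon> \<le> \<psi> b"
          using ev[OF b0(1)]
        proof eventually_elim
          case (elim a)
          then have "(b - a) * (\<phi> a - \<psi> b) \<le> 0"
            using b(2)[of a] incr(1)[of a b] \<Psi>_incr(2)[of b a] b0 by (simp add: D_def algebra_simps)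
          then have "\<phi> a \<le> \<psi> b" using elim by (simp add: mult_le_0_iff)
          then show ?case using approx[of a] elim by simp
        qed
      qed simp
      then have "- \<epsilon> \<le> \<mu> * D b" by (simp add: \<psi>_eq D_def algebra_simps)
      then show ?thesis using \<mu> by (simp add: field_simps)
    qed
    with b(2)[OF s] show ?thesis by simp
  qed
  have upper: "D s \<le> \<epsilon> / \<mu>" if s: "s \<in> {0..t}" for s
  proof -
    obtain b where b: "b \<in> {0..t}" "\<And>s. s \<in> {0..t} \<Longrightarrow> D s \<le> D b"
      using continuous_attains_sup[OF compact_Icc _ D_cont] t by auto
    have "D b \<le> \<epsilon> / \<mu>"
    proof (cases "b = 0")
      case True
      then show ?thesis using D0 \<epsilon> \<mu> by simp
    next
      case False
      with b have b0: "0 < b" "b \<le> t" by auto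
      \<comment> \<open>At a maximum the comparison concerns \<phi> at b itself, and the limit is
        taken in the continuous \<psi>.\<close>
      have "\<psi> b \<le> \<phi> b"
      proof (rule tendsto_upperbound)
        show "(\<psi> \<longlongrightarrow> \<psi> b) (at_left b)"
          by (rule left[OF \<psi>_cont b0])
        show "\<forall>\<^sub>F a in at_left b. \<psi> a \<le> \<phi> b"
          using ev[OF b0(1)]
        proof eventually_elim
          case (elim a)
          then have "0 \<le> (b - a) * (\<phi> b - \<psi> a)"
            using b(2)[of a] incr(2)[of a b] \<Psi>_incr(1)[of b a] b0 by (simp add: D_def algebra_simps)
          then show ?case using elim by (simp add: zero_le_mult_iff)
        qed
      qed simp
      then have "\<mu> * D b \<le> \<epsilon>" using approx[of b] b0 by (simp add: \<psi>_eq D_def algebra_simps)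
      then show ?thesis using \<mu> by (simp add: field_simps)
    qed
    with b(2)[OF s] show ?thesis by simp
  qed
  have "\<bar>\<mu> * D t\<bar> \<le> \<epsilon>"
    using lower[of t] upper[of t] t \<mu> by (simp add: abs_le_iff field_simps)
  \<comment> \<open>One \<epsilon> comes from the equation for \<phi> at t, the other from
    \<open>\<mu> * D t\<close>.\<close>
  moreover have "\<phi> t - \<psi> t = (\<phi> t - \<mu> * (t - \<Phi> t)) - \<mu> * D t"
    by (simp add: \<psi>_eq D_def algebra_simps)
  ultimately show ?thesis using approx[OF t] unfolding \<psi>_def by linarith
qed

text \<open>\<open>A\<close> and \<open>B\<close> are meant to be close to 1 / \<mu>.
  \<open>U\<close> bounds \<phi> t from below. \<open>L\<close> bounds it from above when used at t
  + \<delta>, after which monotonicity of \<Phi> removes the shift.\<close>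

lemma renewal_bounds_imp_approximate:
  fixes \<phi> \<Phi> :: "real \<Rightarrow> real"
  assumes \<mu>: "0 < \<mu>" and \<delta>: "0 \<le> \<delta>" and t: "0 \<le> t"
    and \<phi>: "\<And>t. 0 \<le> \<phi> t" "\<And>t. \<phi> t \<le> 1"
    and incr: "\<And>a b. 0 \<le> a \<Longrightarrow> a \<le> b \<Longrightarrow> (b - a) * \<phi> a \<le> \<Phi> b - \<Phi> a"
    and U: "\<And>t. 0 \<le> t \<Longrightarrow> t - \<alpha> \<le> \<Phi> t + A * \<phi> t"
    and L: "\<And>t. 0 \<le> t \<Longrightarrow> \<Phi> t + B * \<phi> (t - \<delta>) \<le> t"
  shows "\<bar>\<phi> t - \<mu> * (t - \<Phi> t)\<bar> \<le> \<mu> * \<bar>\<alpha>\<bar> + \<bar>1 - \<mu> * A\<bar> + (\<mu> * \<delta> + \<bar>1 - \<mu> * B\<bar>)"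
proof -
  have le: "\<bar>x * \<phi> t\<bar> \<le> \<bar>x\<bar>" for x
    using \<phi>[of t] by (simp add: abs_mult mult_left_le)
  have "\<mu> * (t - \<alpha> - \<Phi> t) \<le> \<mu> * (A * \<phi> t)"
    using U[OF t] \<mu> by (intro mult_left_mono) auto
  moreover have "\<mu> * \<alpha> \<le> \<mu> * \<bar>\<alpha>\<bar>" using \<mu> by simp
  ultimately have low: "- (\<mu> * \<bar>\<alpha>\<bar> + \<bar>1 - \<mu> * A\<bar>) \<le> \<phi> t - \<mu> * (t - \<Phi> t)"
    using le[of "1 - \<mu> * A"] by (simp add: algebra_simps)
  have "0 \<le> \<delta> * \<phi> t" using \<delta> \<phi> by simp
  then have "\<Phi> t \<le> \<Phi> (t + \<delta>)" using incr[of t "t + \<delta>"] t \<delta> by simp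
  then have "B * \<phi> t \<le> t + \<delta> - \<Phi> t"
    using L[of "t + \<delta>"] t \<delta> by simp
  then have "\<mu> * (B * \<phi> t) \<le> \<mu> * (t + \<delta> - \<Phi> t)"
    using \<mu> by (intro mult_left_mono) auto
  then have "\<phi> t - \<mu> * (t - \<Phi> t) \<le> \<mu> * \<delta> + \<bar>1 - \<mu> * B\<bar>"
    using le[of "1 - \<mu> * B"] by (simp add: algebra_simps)
  moreover have "0 \<le> \<mu> * \<bar>\<alpha>\<bar>" "0 \<le> \<mu> * \<delta>" using \<mu> \<delta> by auto
  ultimately show ?thesis using low unfolding abs_le_iff by linarith
qed

subsection \<open>The time to reach the full state\<close>

locale ehrenfest = markov_jump M "{0..N}" "engset_rate N N \<nu> \<mu>" X p
  for M :: "'a measure" and N \<nu> \<mu> X p +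
  assumes \<mu>_pos: "0 < \<mu>" and \<nu>_pos: "0 < \<nu>" and \<mu>\<nu>: "\<mu> + \<nu> = 1" and N_pos: "1 \<le> N"
    and start: "AE \<omega> in M. X 0 \<omega> = 0"
begin

abbreviation H :: "'a \<Rightarrow> ereal" where "H \<equiv> hitting_time X N"

definition hit_cdf :: "real \<Rightarrow> real" where
  "hit_cdf t = \<P>(\<omega> in M. H \<omega> \<le> ereal t)"

text \<open>The integral of \<open>hit_cdf\<close> over \<open>[0, t]\<close>.\<close>

definition hit_excess :: "real \<Rightarrow> real" where
  "hit_excess t = (\<integral>\<omega>. (if H \<omega> \<le> ereal t then t - real_of_ereal (H \<omega>) else 0) \<partial>M)"

text \<open>The integral over [0, s] of the amount by which \<open>p u N N\<close> exceeds its
  stationary value \<open>\<nu> ^ N\<close>.\<close>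

definition top_excess :: "real \<Rightarrow> real" where
  "top_excess s = (\<Sum>i<N. \<nu> ^ (N - Suc i) * (1 - (\<nu> + \<mu> * exp (- s)) ^ Suc i) / real (Suc i))"

lemma H_cases:
  assumes "H \<omega> \<le> ereal t"
  obtains r where "H \<omega> = ereal r" "0 \<le> r" "r \<le> t"
  using assms hitting_time_nonneg[of X N \<omega>] by (cases "H \<omega>") auto

text \<open>The form in \<open>ennreal\<close> permits Tonelli without prior integrability. The base
  on the left is written to match \<open>decay_power_primitive\<close> with \<rho> = -
  \<nu>.\<close>

lemma renewal_equation:
  assumes s: "0 < s"
  shows "ennreal ((\<nu> + - \<nu> * exp (- s)) ^ N) =
    (\<integral>\<^sup>+ \<omega>. ennreal (if H \<omega> \<le> ereal s then (\<nu> + \<mu> * exp (- (s - real_of_ereal (H \<omega>)))) ^ N else 0) \<partial>M)"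
    (is "_ = (\<integral>\<^sup>+ \<omega>. ennreal (?f \<omega>) \<partial>M)")
proof -
  have "(\<nu> + - \<nu> * exp (- s)) ^ N = p s 0 N"
    using ehrenfest_transition_to_top[OF transition \<mu>\<nu>, of s 0] s by (simp add: algebra_simps)
  also have "\<dots> = \<P>(\<omega> in M. X s \<omega> = N)"
    using state_probability[OF _ _ start s] by simp
  also have "\<dots> = (\<integral>\<omega>. (if H \<omega> \<le> ereal s then p (s - real_of_ereal (H \<omega>)) N N else 0) \<partial>M)"
    by (rule first_passage_decomposition[OF _ s]) simp
  also have "\<dots> = (\<integral>\<omega>. ?f \<omega> \<partial>M)"
  proof (rule Bochner_Integration.integral_cong[OF refl])
    fix \<omega>
    show "(if H \<omega> \<le> ereal s then p (s - real_of_ereal (H \<omega>)) N N else 0) = ?f \<omega>"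
      using ehrenfest_transition_to_top[OF transition \<mu>\<nu>, of "s - real_of_ereal (H \<omega>)" N]
      by (auto elim!: H_cases)
  qed
  finally have eq: "(\<nu> + - \<nu> * exp (- s)) ^ N = (\<integral>\<omega>. ?f \<omega> \<partial>M)" .
  have f01: "0 \<le> ?f \<omega> \<and> ?f \<omega> \<le> 1" for \<omega>
  proof (cases "H \<omega> \<le> ereal s")
    case True
    then obtain r where r: "H \<omega> = ereal r" "0 \<le> r" "r \<le> s" by (rule H_cases)
    have "\<mu> * exp (- (s - r)) \<le> \<mu> * 1" using \<mu>_pos r by (intro mult_left_mono) auto
    then have "\<nu> + \<mu> * exp (- (s - r)) \<le> 1" using \<mu>\<nu> by simp
    then show ?thesis using r True \<mu>_pos \<nu>_pos by (auto intro!: power_le_one add_nonneg_nonneg)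
  qed simp
  have "integrable M ?f"
    by (rule integrable_const_bound[where B = 1]) (use f01 in auto)
  then have "(\<integral>\<^sup>+ \<omega>. ennreal (?f \<omega>) \<partial>M) = ennreal (\<integral>\<omega>. ?f \<omega> \<partial>M)"
    by (rule nn_integral_eq_integral) (use f01 in auto)
  then show ?thesis using eq by simp
qed

lemma integrated_renewal_equation:
  assumes t: "0 \<le> t"
  shows "integrable M (\<lambda>\<omega>. if H \<omega> \<le> ereal t then decay_power_primitive \<nu> \<mu> N (t - real_of_ereal (H \<omega>)) else 0)"
      (is "integrable M ?G")
    and "(\<integral>\<omega>. (if H \<omega> \<le> ereal t then decay_power_primitive \<nu> \<mu> N (t - real_of_ereal (H \<omega>)) else 0) \<partial>M)
      = decay_power_primitive \<nu> (- \<nu>) N t"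
proof -
  let ?g = "\<lambda>s \<omega>. if H \<omega> \<le> ereal s then (\<nu> + \<mu> * exp (- (s - real_of_ereal (H \<omega>)))) ^ N else 0"
  interpret lborel_M: pair_sigma_finite lborel M
    by (intro pair_sigma_finite.intro sigma_finite_lborel sigma_finite_measure_axioms)
  have meas: "(\<lambda>(s, \<omega>). ennreal (?g s \<omega>) * indicator {0..t} s) \<in> borel_measurable (lborel \<Otimes>\<^sub>M M)"
    by measurable
  have inner: "(\<integral>\<^sup>+ s. ennreal (?g s \<omega>) * indicator {0..t} s \<partial>lborel) = ennreal (?G \<omega>)" for \<omega>
  proof (cases "H \<omega> \<le> ereal t")
    case True
    then obtain r where r: "H \<omega> = ereal r" "0 \<le> r" "r \<le> t" by (rule H_cases)
    have "(\<integral>\<^sup>+ s. ennreal (?g s \<omega>) * indicator {0..t} s \<partial>lborel) =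
        (\<integral>\<^sup>+ s. ennreal ((\<nu> + \<mu> * exp (- (s - r))) ^ N) * indicator {r..t} s \<partial>lborel)"
      using r by (intro nn_integral_cong) (auto split: split_indicator)
    also have "\<dots> = ennreal (decay_power_primitive \<nu> \<mu> N (t - r))"
      using \<nu>_pos \<mu>\<nu> r by (intro nn_integral_decay_power) auto
    finally show ?thesis using True r by simp
  next
    case False
    then have "\<not> H \<omega> \<le> ereal s" if "s \<le> t" for s
      using that by (meson ereal_less_eq(3) order_trans)
    then have "ennreal (?g s \<omega>) * indicator {0..t} s = 0" for s
      by (auto split: split_indicator)
    then have "(\<integral>\<^sup>+ s. ennreal (?g s \<omega>) * indicator {0..t} s \<partial>lborel) = 0"
      by (simp only: nn_integral_const mult_zero_left)
    then show ?thesis using False by simp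
  qed
  have "ennreal (decay_power_primitive \<nu> (- \<nu>) N t) =
      (\<integral>\<^sup>+ s. ennreal ((\<nu> + - \<nu> * exp (- s)) ^ N) * indicator {0..t} s \<partial>lborel)"
    using nn_integral_decay_power[of \<nu> "- \<nu>" 0 t N] \<nu>_pos t by simp
  also have "\<dots> = (\<integral>\<^sup>+ s. (\<integral>\<^sup>+ \<omega>. ennreal (?g s \<omega>) * indicator {0..t} s \<partial>M) \<partial>lborel)"
  proof (rule nn_integral_cong_AE)
    \<comment> \<open>The renewal equation is available for s > 0 only; s = 0 is a null set.\<close>
    show "AE s in lborel. ennreal ((\<nu> + - \<nu> * exp (- s)) ^ N) * indicator {0..t} s =
        (\<integral>\<^sup>+ \<omega>. ennreal (?g s \<omega>) * indicator {0..t} s \<partial>M)"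
      using AE_lborel_singleton[of 0]
    proof eventually_elim
      case (elim s)
      show ?case
      proof (cases "0 < s")
        case True
        show ?thesis
          unfolding renewal_equation[OF True] by (rule nn_integral_multc[symmetric]) measurable
      next
        case False
        then show ?thesis using elim by simp
      qed
    qed
  qed
  also have "\<dots> = (\<integral>\<^sup>+ \<omega>. (\<integral>\<^sup>+ s. ennreal (?g s \<omega>) * indicator {0..t} s \<partial>lborel) \<partial>M)"
    by (rule lborel_M.Fubini'[OF meas, symmetric])
  also have "\<dots> = (\<integral>\<^sup>+ \<omega>. ennreal (?G \<omega>) \<partial>M)"
    by (simp only: inner)
  finally have nn: "(\<integral>\<^sup>+ \<omega>. ennreal (?G \<omega>) \<partial>M) = ennreal (decay_power_primitive \<nu> (- \<nu>) N t)"
    by simp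
  have "0 \<le> ?G \<omega>" for \<omega>
    using \<mu>_pos \<nu>_pos by (auto intro!: decay_power_primitive_nonneg elim!: H_cases)
  moreover have "0 \<le> decay_power_primitive \<nu> (- \<nu>) N t"
    using \<nu>_pos t by (intro decay_power_primitive_nonneg) auto
  moreover have "?G \<in> borel_measurable M"
    unfolding decay_power_primitive_def by measurable
  ultimately have "integrable M ?G \<and> (\<integral>\<omega>. ?G \<omega> \<partial>M) = decay_power_primitive \<nu> (- \<nu>) N t"
    using nn by (subst nn_integral_eq_integrable[symmetric]) auto
  then show "integrable M ?G" "(\<integral>\<omega>. ?G \<omega> \<partial>M) = decay_power_primitive \<nu> (- \<nu>) N t"
    by auto
qed

section \<open>Bounds from the integrated renewal equation\<close>

lemma decay_power_primitive_top:
  "decay_power_primitive \<nu> \<mu> N s = \<nu> ^ N * s + top_excess s"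
  using \<mu>\<nu> by (simp add: decay_power_primitive_def top_excess_def add.commute)

text \<open>The correction to the linear term is \<open>\<nu> ^ N\<close> times a sum between 0 and
  N. The crude bound N suffices: after multiplication by N the error is N^2 * \<nu> ^ N, which still
  vanishes.\<close>

lemma decay_power_primitive_bottom:
  assumes "0 \<le> s"
  shows "\<nu> ^ N * (s - real N) \<le> decay_power_primitive \<nu> (- \<nu>) N s"
    and "decay_power_primitive \<nu> (- \<nu>) N s \<le> \<nu> ^ N * s"
proof -
  let ?x = "1 - exp (- s)"
  have x: "0 \<le> ?x" "?x \<le> 1" using assms by auto
  have "\<nu> ^ (N - Suc i) * ((\<nu> + - \<nu>) ^ Suc i - (\<nu> + - \<nu> * exp (- s)) ^ Suc i) / real (Suc i)
      = - (\<nu> ^ N * (?x ^ Suc i / real (Suc i)))" if "i < N" for i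
  proof -
    have "(\<nu> + - \<nu> * exp (- s)) ^ Suc i = \<nu> ^ Suc i * ?x ^ Suc i"
      unfolding power_mult_distrib[symmetric] by (simp add: algebra_simps)
    moreover have "\<nu> ^ N = \<nu> ^ (N - Suc i) * \<nu> ^ Suc i"
      using that by (simp only: power_add[symmetric]) simp
    ultimately show ?thesis by (simp del: power_Suc of_nat_Suc add: power_0_Suc)
  qed
  then have eq: "decay_power_primitive \<nu> (- \<nu>) N s = \<nu> ^ N * s - \<nu> ^ N * (\<Sum>i<N. ?x ^ Suc i / real (Suc i))"
    unfolding decay_power_primitive_def by (simp add: sum_negf sum_distrib_left)
  have "(\<Sum>i<N. ?x ^ Suc i / real (Suc i)) \<le> (\<Sum>i<N. 1)"
  proof (rule sum_mono)
    fix i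
    have "?x ^ Suc i \<le> 1" using x by (rule power_le_one)
    then show "?x ^ Suc i / real (Suc i) \<le> 1" by (simp add: divide_le_eq del: power_Suc)
  qed
  then have "\<nu> ^ N * (\<Sum>i<N. ?x ^ Suc i / real (Suc i)) \<le> \<nu> ^ N * real N"
    using \<nu>_pos by (intro mult_left_mono) auto
  then show "\<nu> ^ N * (s - real N) \<le> decay_power_primitive \<nu> (- \<nu>) N s"
    by (simp add: eq right_diff_distrib)
  have "0 \<le> \<nu> ^ N * (\<Sum>i<N. ?x ^ Suc i / real (Suc i))"
    using \<nu>_pos x by (intro mult_nonneg_nonneg sum_nonneg) auto
  then show "decay_power_primitive \<nu> (- \<nu>) N s \<le> \<nu> ^ N * s"
    by (simp add: eq)
qed

lemma top_excess_mono:
  assumes "0 \<le> s" "s \<le> s'"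
  shows "top_excess s \<le> top_excess s'"
  unfolding top_excess_def
proof (intro sum_mono divide_right_mono mult_left_mono diff_left_mono power_mono)
  show "\<nu> + \<mu> * exp (- s') \<le> \<nu> + \<mu> * exp (- s)" using assms \<mu>_pos by simp
qed (use \<mu>_pos \<nu>_pos in \<open>auto intro: add_nonneg_nonneg\<close>)

lemma top_excess_nonneg: "0 \<le> s \<Longrightarrow> 0 \<le> top_excess s"
  using top_excess_mono[of 0 s] \<mu>\<nu> by (simp add: top_excess_def add.commute)

text \<open>Dropping the nonnegative subtracted powers gives a bound free of s. Nothing is lost
  asymptotically, since N times the sum tends to 1 / (1 - \<nu>) for every base in [0, 1);
  \<open>0 ^ Suc i\<close> is kept so that the bound is the instance with base 0.\<close>

lemma top_excess_le: "top_excess s \<le> (\<Sum>i<N. \<nu> ^ (N - Suc i) * (1 - 0 ^ Suc i) / real (Suc i))"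
  unfolding top_excess_def
  using \<mu>_pos \<nu>_pos by (intro sum_mono divide_right_mono mult_left_mono diff_left_mono power_mono)
    (auto intro: add_nonneg_nonneg)

lemma integral_hit: "(\<integral>\<omega>. (if H \<omega> \<le> ereal t then 1 else 0) \<partial>M) = hit_cdf t"
    and integrable_hit [simp]: "integrable M (\<lambda>\<omega>. if H \<omega> \<le> ereal t then 1 else 0 :: real)"
proof -
  have "(\<integral>\<omega>. (if H \<omega> \<le> ereal t then 1 else 0) \<partial>M) = (\<integral>\<omega>. indicator {\<omega> \<in> space M. H \<omega> \<le> ereal t} \<omega> \<partial>M)"
    by (intro Bochner_Integration.integral_cong) auto
  also have "\<dots> = hit_cdf t"
    by (simp add: hit_cdf_def)
  finally show "(\<integral>\<omega>. (if H \<omega> \<le> ereal t then 1 else 0) \<partial>M) = hit_cdf t" .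
  show "integrable M (\<lambda>\<omega>. if H \<omega> \<le> ereal t then 1 else 0 :: real)"
    by (rule integrable_const_bound[where B = 1]) auto
qed

lemma integrable_excess [simp]:
  "integrable M (\<lambda>\<omega>. if H \<omega> \<le> ereal t then t - real_of_ereal (H \<omega>) else 0)"
  by (rule integrable_const_bound[where B = "\<bar>t\<bar>"]) (auto elim!: H_cases)

lemma hit_upper:
  assumes t: "0 \<le> t"
  shows "\<nu> ^ N * (t - real N) \<le> \<nu> ^ N * hit_excess t +
    (\<Sum>i<N. \<nu> ^ (N - Suc i) * (1 - 0 ^ Suc i) / real (Suc i)) * hit_cdf t" (is "_ \<le> _ + ?A * _")
proof -
  have "\<nu> ^ N * (t - real N) \<le> (\<integral>\<omega>. (if H \<omega> \<le> ereal t then decay_power_primitive \<nu> \<mu> N (t - real_of_ereal (H \<omega>)) else 0) \<partial>M)"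
    using decay_power_primitive_bottom(1)[OF t] integrated_renewal_equation(2)[OF t] by simp
  also have "\<dots> \<le> (\<integral>\<omega>. \<nu> ^ N * (if H \<omega> \<le> ereal t then t - real_of_ereal (H \<omega>) else 0)
      + ?A * (if H \<omega> \<le> ereal t then 1 else 0) \<partial>M)"
    using top_excess_le by (intro integral_mono integrated_renewal_equation(1)[OF t])
      (auto simp: decay_power_primitive_top simp del: power_Suc)
  also have "\<dots> = \<nu> ^ N * hit_excess t + ?A * hit_cdf t"
    by (simp add: hit_excess_def integral_hit del: power_Suc)
  finally show ?thesis .
qed

text \<open>A path that reaches the full state by t - d has collected at least
  \<open>top_excess d\<close> by time t; for a hit between t - d and t the excess is only bounded
  below by 0.\<close>

lemma hit_lower:
  assumes t: "0 \<le> t" and d: "0 \<le> d"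
  shows "\<nu> ^ N * hit_excess t + top_excess d * hit_cdf (t - d) \<le> \<nu> ^ N * t"
proof -
  have "\<nu> ^ N * hit_excess t + top_excess d * hit_cdf (t - d) =
      (\<integral>\<omega>. \<nu> ^ N * (if H \<omega> \<le> ereal t then t - real_of_ereal (H \<omega>) else 0)
      + top_excess d * (if H \<omega> \<le> ereal (t - d) then 1 else 0) \<partial>M)"
    by (simp add: hit_excess_def integral_hit)
  also have "\<dots> \<le> (\<integral>\<omega>. (if H \<omega> \<le> ereal t then decay_power_primitive \<nu> \<mu> N (t - real_of_ereal (H \<omega>)) else 0) \<partial>M)"
  proof (intro integral_mono integrated_renewal_equation(1)[OF t])
    fix \<omega>
    show "\<nu> ^ N * (if H \<omega> \<le> ereal t then t - real_of_ereal (H \<omega>) else 0)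
      + top_excess d * (if H \<omega> \<le> ereal (t - d) then 1 else 0)
      \<le> (if H \<omega> \<le> ereal t then decay_power_primitive \<nu> \<mu> N (t - real_of_ereal (H \<omega>)) else 0)"
    proof (cases "H \<omega> \<le> ereal t")
      case True
      then obtain r where r: "H \<omega> = ereal r" "0 \<le> r" "r \<le> t" by (rule H_cases)
      then show ?thesis
        using top_excess_mono[OF d, of "t - r"] top_excess_nonneg[of "t - r"]
        by (auto simp: decay_power_primitive_top)
    next
      case False
      then have "\<not> H \<omega> \<le> ereal (t - d)"
        using order_trans[of "H \<omega>" "ereal (t - d)" "ereal t"] d by auto
      then show ?thesis using False by simp
    qed
  qed simp
  also have "\<dots> \<le> \<nu> ^ N * t"
    using decay_power_primitive_bottom(2)[OF t] integrated_renewal_equation(2)[OF t] by simp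
  finally show ?thesis .
qed

text \<open>Pathwise, the positive part of t - H grows by exactly b - a if H is at most a, and by at
  most b - a if H lies in between. These inequalities stand in for \<open>hit_cdf\<close> being the
  derivative, which can fail at a jump.\<close>

lemma hit_excess_incr:
  assumes ab: "a \<le> b"
  shows "(b - a) * hit_cdf a \<le> hit_excess b - hit_excess a"
    and "hit_excess b - hit_excess a \<le> (b - a) * hit_cdf b"
proof -
  let ?e = "\<lambda>t \<omega>. if H \<omega> \<le> ereal t then t - real_of_ereal (H \<omega>) else 0"
  have diff: "hit_excess b - hit_excess a = (\<integral>\<omega>. ?e b \<omega> - ?e a \<omega> \<partial>M)"
    unfolding hit_excess_def by (rule Bochner_Integration.integral_diff[symmetric]) simp_all
  have le: "H \<omega> \<le> ereal b" if "H \<omega> \<le> ereal a" for \<omega>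
    using that ab by (meson ereal_less_eq(3) order_trans)
  have "(b - a) * hit_cdf a = (\<integral>\<omega>. (b - a) * (if H \<omega> \<le> ereal a then 1 else 0) \<partial>M)"
    by (simp add: integral_hit)
  also have "\<dots> \<le> (\<integral>\<omega>. ?e b \<omega> - ?e a \<omega> \<partial>M)"
  proof (rule integral_mono)
    fix \<omega>
    show "(b - a) * (if H \<omega> \<le> ereal a then 1 else 0) \<le> ?e b \<omega> - ?e a \<omega>"
      using le[of \<omega>] by (auto elim!: H_cases)
  qed simp_all
  finally show "(b - a) * hit_cdf a \<le> hit_excess b - hit_excess a" by (simp only: diff)
  have "(\<integral>\<omega>. ?e b \<omega> - ?e a \<omega> \<partial>M) \<le> (\<integral>\<omega>. (b - a) * (if H \<omega> \<le> ereal b then 1 else 0) \<partial>M)"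
  proof (rule integral_mono)
    fix \<omega>
    show "?e b \<omega> - ?e a \<omega> \<le> (b - a) * (if H \<omega> \<le> ereal b then 1 else 0)"
      using le[of \<omega>] by (cases "H \<omega>") auto
  qed simp_all
  also have "\<dots> = (b - a) * hit_cdf b"
    by (simp add: integral_hit)
  finally show "hit_excess b - hit_excess a \<le> (b - a) * hit_cdf b" by (simp only: diff)
qed

lemma hit_excess_0: "hit_excess 0 = 0"
proof -
  have "(if H \<omega> \<le> ereal 0 then 0 - real_of_ereal (H \<omega>) else 0) = 0" for \<omega>
    by (auto elim!: H_cases)
  then show ?thesis unfolding hit_excess_def by simp
qed

end

section \<open>Rescaling and passage to the limit\<close>

lemma (in ehrenfest) scaled_hit_cdf_approx:
  assumes x: "0 \<le> x"
  shows "\<bar>hit_cdf (x / (real N * \<nu> ^ N)) - (1 - exp (- \<mu> * x))\<bar> \<le>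
    2 * (\<mu> * \<bar>(real N)\<^sup>2 * \<nu> ^ N\<bar>
      + \<bar>1 - \<mu> * (real N * (\<Sum>i<N. \<nu> ^ (N - Suc i) * (1 - 0 ^ Suc i) / real (Suc i)))\<bar>
      + (\<mu> * (real N * \<nu> ^ N)
        + \<bar>1 - \<mu> * (real N * (\<Sum>i<N. \<nu> ^ (N - Suc i) * (1 - (\<nu> + \<mu> * exp (- 1)) ^ Suc i) / real (Suc i)))\<bar>))"
    (is "_ \<le> 2 * (\<mu> * \<bar>_\<bar> + \<bar>1 - \<mu> * (real N * ?A)\<bar> + (\<mu> * _ + \<bar>1 - \<mu> * (real N * ?B)\<bar>))")
proof -
  define c where "c = real N * \<nu> ^ N"
  have c: "0 < c" using N_pos \<nu>_pos by (simp add: c_def)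
  have B: "?B = top_excess 1" by (simp add: top_excess_def)
  define \<phi> where "\<phi> t = hit_cdf (t / c)" for t
  \<comment> \<open>The factor \<open>c\<close> makes \<Phi> the integral of \<phi> under the
    substitution of t / c for t.\<close>
  define \<Phi> where "\<Phi> t = c * hit_excess (t / c)" for t
  have \<phi>01: "0 \<le> \<phi> t" "\<phi> t \<le> 1" for t
    by (simp_all add: \<phi>_def hit_cdf_def)
  have incr: "(b - a) * \<phi> a \<le> \<Phi> b - \<Phi> a" "\<Phi> b - \<Phi> a \<le> (b - a) * \<phi> b" if "a \<le> b" for a b
  proof -
    have *: "(b - a) * y = c * ((b / c - a / c) * y)" for y
      using c by (simp add: field_simps)
    have "a / c \<le> b / c" using that c by (simp add: divide_right_mono)
    then show "(b - a) * \<phi> a \<le> \<Phi> b - \<Phi> a" "\<Phi> b - \<Phi> a \<le> (b - a) * \<phi> b"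
      using hit_excess_incr[of "a / c" "b / c"] c
      unfolding * \<Phi>_def \<phi>_def right_diff_distrib[symmetric] by simp_all
  qed
  \<comment> \<open>Multiplication by N turns the weight \<open>\<nu> ^ N\<close> into
    \<open>c\<close> and the error \<open>\<nu> ^ N * real N\<close> into N^2 * \<nu> ^ N.\<close>
  have U: "t - (real N)\<^sup>2 * \<nu> ^ N \<le> \<Phi> t + (real N * ?A) * \<phi> t" if t: "0 \<le> t" for t
  proof -
    have "real N * (\<nu> ^ N * (t / c - real N)) \<le> real N * (\<nu> ^ N * hit_excess (t / c) + ?A * hit_cdf (t / c))"
      using t c by (intro mult_left_mono hit_upper) auto
    moreover have "real N * (\<nu> ^ N * (t / c - real N)) = c * (t / c) - (real N)\<^sup>2 * \<nu> ^ N"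
      by (simp add: c_def power2_eq_square algebra_simps)
    moreover have "c * (t / c) = t" using c by simp
    moreover have "c * (t / c) = t" using c by simp
    ultimately show ?thesis
      using c by (simp add: \<Phi>_def \<phi>_def c_def distrib_left mult.assoc del: power_Suc)
  qed
  \<comment> \<open>The delay d = 1 becomes \<open>c\<close> after scaling and disappears in the
    limit. A fixed positive delay already captures asymptotically the whole excess, because its base
    \<nu> + \<mu> * exp (- 1) is below 1.\<close>
  have L: "\<Phi> t + (real N * ?B) * \<phi> (t - c) \<le> t" if t: "0 \<le> t" for t
  proof -
    have "real N * (\<nu> ^ N * hit_excess (t / c) + top_excess 1 * hit_cdf (t / c - 1)) \<le> real N * (\<nu> ^ N * (t / c))"
      using t c by (intro mult_left_mono hit_lower) auto
    moreover have "real N * (\<nu> ^ N * (t / c)) = t"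
    proof -
      have "real N * (\<nu> ^ N * (t / c)) = c * (t / c)"
        unfolding c_def by (simp only: mult.assoc)
      then show ?thesis using c by simp
    qed
    moreover have "(t - c) / c = t / c - 1"
      using c by (simp add: diff_divide_distrib)
    ultimately show ?thesis
      unfolding B \<Phi>_def \<phi>_def by (simp add: c_def distrib_left mult.assoc)
  qed
  have "\<bar>\<phi> x - (1 - exp (- \<mu> * x))\<bar> \<le> 2 * (\<mu> * \<bar>(real N)\<^sup>2 * \<nu> ^ N\<bar>
      + \<bar>1 - \<mu> * (real N * ?A)\<bar> + (\<mu> * c + \<bar>1 - \<mu> * (real N * ?B)\<bar>))"
  proof (rule approximate_exponential_cdf[where \<Phi> = \<Phi>, OF \<mu>_pos _ \<phi>01 incr _ x])
    show "\<Phi> 0 = 0" by (simp add: \<Phi>_def hit_excess_0)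
    show "\<bar>\<phi> t - \<mu> * (t - \<Phi> t)\<bar> \<le> \<mu> * \<bar>(real N)\<^sup>2 * \<nu> ^ N\<bar>
      + \<bar>1 - \<mu> * (real N * ?A)\<bar> + (\<mu> * c + \<bar>1 - \<mu> * (real N * ?B)\<bar>)" if "0 \<le> t" for t
      by (rule renewal_bounds_imp_approximate[where \<phi> = \<phi> and \<Phi> = \<Phi>, OF \<mu>_pos less_imp_le[OF c] that \<phi>01 incr(1) U L])
  qed
  then show ?thesis by (simp only: \<phi>_def c_def)
qed

lemma engset_process_imp_ehrenfest:
  assumes "engset_process M N N \<nu> \<mu> X" "\<mu> + \<nu> = 1" "AE \<omega> in M. X 0 \<omega> = 0"
  shows "\<exists>p. ehrenfest M N \<nu> \<mu> X p"
proof -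
  have "markov_jump_process M {0..N} (engset_rate N N \<nu> \<mu>) X"
    using assms(1) by (simp add: engset_process_def)
  then obtain p where "markov_jump M {0..N} (engset_rate N N \<nu> \<mu>) X p"
    using markov_jump_process_imp_markov_jump by blast
  then have "ehrenfest M N \<nu> \<mu> X p"
    using assms by (simp add: ehrenfest_def ehrenfest_axioms_def engset_process_def)
  then show ?thesis by blast
qed

lemma cdf_exponential:
  assumes "0 < l"
  shows "cdf (density lborel (exponential_density l)) x = (if x < 0 then 0 else 1 - exp (- l * x))"
  using emeasure_erlang_density[OF assms, of 0 x] assms
  by (auto simp: cdf_def measure_def erlang_CDF_def)

theorem proposition7:
  fixes \<mu> \<nu> :: real
    and M :: "nat \<Rightarrow> 'a measure"
    and X :: "nat \<Rightarrow> real \<Rightarrow> 'a \<Rightarrow> nat"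
  assumes "0 < \<mu>" and "0 < \<nu>" and "\<mu> + \<nu> = 1"
    and "\<And>N. 1 \<le> N \<Longrightarrow> engset_process (M N) N N \<nu> \<mu> (X N)"
    and "\<And>N. 1 \<le> N \<Longrightarrow> AE \<omega> in M N. X N 0 \<omega> = 0"
  shows "converges_in_distribution M
           (\<lambda>N \<omega>. ereal (real N * \<nu> ^ N) * hitting_time (X N) N \<omega>)
           (density lborel (exponential_density (1 - \<nu>)))"
  unfolding converges_in_distribution_def weak_conv_def
proof (intro allI impI)
  fix x :: real
  let ?F = "\<lambda>N. \<P>(\<omega> in M N. ereal (real N * \<nu> ^ N) * hitting_time (X N) N \<omega> \<le> ereal x)"
  have \<mu>: "1 - \<nu> = \<mu>" and \<nu>1: "\<nu> < 1" using assms by auto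
  \<comment> \<open>For an infinite hitting time both sides are false, because the factor is
    positive.\<close>
  have iff: "ereal (real N * \<nu> ^ N) * hitting_time (X N) N \<omega> \<le> ereal x \<longleftrightarrow>
      hitting_time (X N) N \<omega> \<le> ereal (x / (real N * \<nu> ^ N))" if "1 \<le> N" for N \<omega>
  proof -
    have "0 < real N * \<nu> ^ N" using that assms(2) by simp
    then show ?thesis
      using hitting_time_nonneg[of "X N" N \<omega>] assms(2)
      by (cases "hitting_time (X N) N \<omega>") (auto simp: pos_le_divide_eq mult.commute)
  qed
  have "?F \<longlonglongrightarrow> (if x < 0 then 0 else 1 - exp (- \<mu> * x))"
  proof (cases "x < 0")
    case True
    have "?F N = 0" if "1 \<le> N" for N
    proof -
      have "x / (real N * \<nu> ^ N) < 0" using True that assms(2) by (simp add: divide_neg_pos)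
      then have "\<not> hitting_time (X N) N \<omega> \<le> ereal (x / (real N * \<nu> ^ N))" for \<omega>
        using hitting_time_nonneg[of "X N" N \<omega>] by (cases "hitting_time (X N) N \<omega>") auto
      then show ?thesis by (simp add: iff[OF that])
    qed
    then have "eventually (\<lambda>N. 0 = ?F N) sequentially"
      by (intro eventually_mono[OF eventually_ge_at_top[of 1]]) simp
    with True show ?thesis
      by (simp add: Lim_transform_eventually[OF tendsto_const])
  next
    case False
    then have x: "0 \<le> x" by simp
    define S where "S b N = real N * (\<Sum>i<N. \<nu> ^ (N - Suc i) * (1 - b ^ Suc i) / real (Suc i))" for b :: real and N
    define \<epsilon> where "\<epsilon> N = 2 * (\<mu> * \<bar>(real N)\<^sup>2 * \<nu> ^ N\<bar> + \<bar>1 - \<mu> * S 0 N\<bar>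
      + (\<mu> * (real N * \<nu> ^ N) + \<bar>1 - \<mu> * S (\<nu> + \<mu> * exp (- 1)) N\<bar>))" for N
    have S: "S b \<longlonglongrightarrow> 1 / \<mu>" if "0 \<le> b" "b < 1" for b
      unfolding S_def using scaled_harmonic_geometric_limit[OF assms(2) \<nu>1 that] by (simp only: \<mu>)
    have "\<mu> * exp (- 1) < \<mu> * 1" using assms(1) by (intro mult_strict_left_mono) auto
    then have "\<nu> + \<mu> * exp (- 1) < 1"
      using assms(3) by linarith
    then have b: "0 \<le> \<nu> + \<mu> * exp (- 1)" "\<nu> + \<mu> * exp (- 1) < 1"
      using assms(1-3) by (simp_all add: add.commute)
    \<comment> \<open>Both sums \<open>S\<close> tend to 1 / \<mu>, so the upper and the lower bound
      on the excess mass agree in the limit.\<close>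
    have "\<epsilon> \<longlonglongrightarrow> 2 * (\<mu> * \<bar>0\<bar> + \<bar>1 - \<mu> * (1 / \<mu>)\<bar> + (\<mu> * 0 + \<bar>1 - \<mu> * (1 / \<mu>)\<bar>))"
      unfolding \<epsilon>_def using assms(2) \<nu>1 b
      by (intro tendsto_intros S square_times_power_limit powser_times_n_limit_0) auto
    then have \<epsilon>0: "\<epsilon> \<longlonglongrightarrow> 0" using assms(1) by simp
    have bound: "\<bar>?F N - (1 - exp (- \<mu> * x))\<bar> \<le> \<epsilon> N" if N: "1 \<le> N" for N
    proof -
      obtain p where "ehrenfest (M N) N \<nu> \<mu> (X N) p"
        using engset_process_imp_ehrenfest[OF assms(4)[OF N] assms(3) assms(5)[OF N]] by blast
      then interpret ehrenfest "M N" N \<nu> \<mu> "X N" p .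
      have "?F N = hit_cdf (x / (real N * \<nu> ^ N))"
        by (simp only: hit_cdf_def iff[OF N])
      then show ?thesis
        using scaled_hit_cdf_approx[OF x] by (simp only: \<epsilon>_def S_def)
    qed
    have "(\<lambda>N. ?F N - (1 - exp (- \<mu> * x))) \<longlonglongrightarrow> 0"
      by (rule Lim_null_comparison[OF _ \<epsilon>0])
        (use bound in \<open>auto intro!: eventually_mono[OF eventually_ge_at_top[of 1]]\<close>)
    then show ?thesis using False by (simp add: LIM_zero_iff)
  qed
  then show "?F \<longlonglongrightarrow> cdf (density lborel (exponential_density (1 - \<nu>))) x"
    using assms(1) by (simp add: \<mu> cdf_exponential)
qed

end
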